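(* Let $M$ be an oriented smooth manifold of dimension $n\ge 3$, possibly with boundary, equipped with a conformal class $[g]$ of Riemannian metrics, and let $\beta\in\Omega^{n-1}(M)$ be a closed, nowhere vanishing $(n-1)$-form. Then there exists a metric in $[g]$ with respect to which $\beta$ is harmonic if and only if there exists a (possibly different) metric in $[g]$ with respect to which $\beta$ is eikonal.
   Context: All objects are smooth. Two Riemannian metrics $g,h$ on $M$ are conformally equivalent if $h=e^{2u}g$ for some $u\in C^\infty(M)$; $[g]$ denotes the set of all metrics conformally equivalent to $g$. A closed form $\beta\in\Omega^{n-1}(M)$ is called a flux form. Given a Riemannian metric $g$ with Hodge star $\star$ and pointwise norm $|\cdot|$ on forms: $\beta$ is harmonic if $d\star\beta=0$. A normalization of a form $\alpha\in\Omega^k(M)$ is a form $\xi\in\Omega^k(M)$ with $|\alpha|\,\xi=\alpha$ and $|\xi|\le 1$. A closed form $\beta\in\Omega^{n-1}(M)$ is eikonal if there exists a closed normalization $\eta\in\Omega^1(M)$ of $\star\beta$. *)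

theory Defs
  imports "HOL-Analysis.Analysis"
begin

section \<open>Smooth maps on subsets of Euclidean space\<close>

fun Ck_on :: "nat \<Rightarrow> 'a::real_normed_vector set \<Rightarrow> ('a \<Rightarrow> 'b::real_normed_vector) \<Rightarrow> bool" where
  "Ck_on 0 W f \<longleftrightarrow> continuous_on W f"
| "Ck_on (Suc k) W f \<longleftrightarrow>
     (\<forall>x\<in>W. f differentiable (at x)) \<and> (\<forall>v. Ck_on k W (\<lambda>x. frechet_derivative f (at x) v))"

text \<open>The set \<open>S\<close> need not be open: smoothness means local extendability to smooth maps on
  open sets, as is usual on subsets of a half-space.\<close>

definition smooth_on :: "'a::real_normed_vector set \<Rightarrow> ('a \<Rightarrow> 'b::real_normed_vector) \<Rightarrow> bool" where
  "smooth_on S f \<longleftrightarrow>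
     (\<forall>x\<in>S. \<exists>W F. open W \<and> x \<in> W \<and> (\<forall>k. Ck_on k W F) \<and> (\<forall>y\<in>S \<inter> W. F y = f y))"


section \<open>Oriented smooth manifolds with boundary\<close>

text \<open>The dimension is \<open>CARD('n)\<close>. The order on the index type \<open>'n\<close> is only used to single out
  the last coordinate and to number the standard basis vectors.\<close>

definition half_space :: "(real^'n::{finite,wellorder}) set" where
  "half_space = {x. 0 \<le> x $ Max UNIV}"

text \<open>A chart is its domain together with the coordinate map; the values of the latter outside the
  domain are irrelevant.\<close>

type_synonym ('a,'n) chart = "'a set \<times> ('a \<Rightarrow> real^'n)"

definition chart_image :: "('a,'n::finite) chart \<Rightarrow> (real^'n) set" where
  "chart_image c = snd c ` fst c"

definition is_chart :: "'a topology \<Rightarrow> ('a,'n::{finite,wellorder}) chart \<Rightarrow> bool" where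
  "is_chart M c \<longleftrightarrow>
     openin M (fst c) \<and>
     openin (top_of_set half_space) (chart_image c) \<and>
     homeomorphic_map (subtopology M (fst c)) (top_of_set (chart_image c)) (snd c)"

definition overlap :: "('a,'n::finite) chart \<Rightarrow> ('a,'n) chart \<Rightarrow> (real^'n) set" where
  "overlap c c' = snd c ` (fst c \<inter> fst c')"

definition transition :: "('a,'n::finite) chart \<Rightarrow> ('a,'n) chart \<Rightarrow> real^'n \<Rightarrow> real^'n" where
  "transition c c' = snd c' \<circ> inv_into (fst c) (snd c)"

text \<open>Overlaps are relatively open in the half-space, so the derivative within them is unique also
  at boundary points.\<close>

definition transition_deriv ::
    "('a,'n::finite) chart \<Rightarrow> ('a,'n) chart \<Rightarrow> real^'n \<Rightarrow> real^'n \<Rightarrow> real^'n" where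
  "transition_deriv c c' x = frechet_derivative (transition c c') (at x within overlap c c')"

definition smooth_manifold_with_boundary ::
    "'a topology \<Rightarrow> ('a,'n::{finite,wellorder}) chart set \<Rightarrow> bool" where
  "smooth_manifold_with_boundary M A \<longleftrightarrow>
     Hausdorff_space M \<and> second_countable M \<and>
     (\<forall>c\<in>A. is_chart M c) \<and>
     (\<Union>c\<in>A. fst c) = topspace M \<and>
     (\<forall>c\<in>A. \<forall>c'\<in>A. smooth_on (overlap c c') (transition c c'))"

text \<open>An orientation is given by the atlas itself. In dimension at least 2 every oriented manifold
  with boundary has such an atlas with values in the fixed half-space.\<close>

definition oriented_atlas :: "('a,'n::{finite,wellorder}) chart set \<Rightarrow> bool" where
  "oriented_atlas A \<longleftrightarrow>
     (\<forall>c\<in>A. \<forall>c'\<in>A. \<forall>x\<in>overlap c c'. 0 < det (matrix (transition_deriv c c' x)))"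

definition smooth_function :: "('a,'n::finite) chart set \<Rightarrow> ('a \<Rightarrow> real) \<Rightarrow> bool" where
  "smooth_function A u \<longleftrightarrow>
     (\<forall>c\<in>A. smooth_on (chart_image c) (u \<circ> inv_into (fst c) (snd c)))"


section \<open>Differential forms and Riemannian metrics\<close>

text \<open>Tensor fields are families of local representations, one on the image of each chart of the
  atlas, related by pullback along the transition maps. A \<open>k\<close>-covector takes the list of its \<open>k\<close>
  arguments; its values on lists of other lengths are irrelevant.\<close>

type_synonym ('a,'n) form = "('a,'n) chart \<Rightarrow> real^'n \<Rightarrow> (real^'n) list \<Rightarrow> real"
type_synonym ('a,'n) metric = "('a,'n) chart \<Rightarrow> real^'n \<Rightarrow> real^'n \<Rightarrow> real^'n \<Rightarrow> real"

definition alternating_multilinear :: "nat \<Rightarrow> ((real^'n) list \<Rightarrow> real) \<Rightarrow> bool" where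
  "alternating_multilinear k f \<longleftrightarrow>
     (\<forall>vs. length vs = k \<longrightarrow>
        (\<forall>i<k. linear (\<lambda>v. f (vs[i := v]))) \<and>
        (\<forall>i<k. \<forall>j<k. i \<noteq> j \<and> vs ! i = vs ! j \<longrightarrow> f vs = 0))"

text \<open>\<open>k_forms A k\<close> is \<open>\<Omega>\<^sup>k(M)\<close>.\<close>

definition k_forms :: "('a,'n::finite) chart set \<Rightarrow> nat \<Rightarrow> ('a,'n) form set" where
  "k_forms A k = {\<omega>.
     (\<forall>c\<in>A. \<forall>x\<in>chart_image c. alternating_multilinear k (\<omega> c x)) \<and>
     (\<forall>c\<in>A. \<forall>vs. length vs = k \<longrightarrow> smooth_on (chart_image c) (\<lambda>x. \<omega> c x vs)) \<and>
     (\<forall>c\<in>A. \<forall>c'\<in>A. \<forall>x\<in>overlap c c'. \<forall>vs. length vs = k \<longrightarrow>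
        \<omega> c x vs = \<omega> c' (transition c c' x) (map (transition_deriv c c' x) vs))}"

definition riemannian_metric :: "('a,'n::finite) chart set \<Rightarrow> ('a,'n) metric \<Rightarrow> bool" where
  "riemannian_metric A g \<longleftrightarrow>
     (\<forall>c\<in>A. \<forall>x\<in>chart_image c.
        bilinear (g c x) \<and> (\<forall>v w. g c x v w = g c x w v) \<and> (\<forall>v. v \<noteq> 0 \<longrightarrow> 0 < g c x v v)) \<and>
     (\<forall>c\<in>A. \<forall>v w. smooth_on (chart_image c) (\<lambda>x. g c x v w)) \<and>
     (\<forall>c\<in>A. \<forall>c'\<in>A. \<forall>x\<in>overlap c c'. \<forall>v w.
        g c x v w =
          g c' (transition c c' x) (transition_deriv c c' x v) (transition_deriv c c' x w))"

definition conformal_class ::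
    "('a,'n::finite) chart set \<Rightarrow> ('a,'n) metric \<Rightarrow> ('a,'n) metric set" where
  "conformal_class A g = {h. riemannian_metric A h \<and>
     (\<exists>u. smooth_function A u \<and>
        (\<forall>c\<in>A. \<forall>p\<in>fst c. \<forall>v w. h c (snd c p) v w = exp (2 * u p) * g c (snd c p) v w))}"

text \<open>The degree of the differentiated form is read off from the number of arguments. The formula is
  the usual one for constant vector fields in the coordinates of \<open>c\<close>.\<close>

definition exterior_derivative :: "('a,'n::finite) form \<Rightarrow> ('a,'n) form" where
  "exterior_derivative \<omega> c x vs =
     (\<Sum>i<length vs. (-1) ^ i *
        frechet_derivative (\<lambda>y. \<omega> c y (take i vs @ drop (Suc i) vs))
          (at x within chart_image c) (vs ! i))"

definition closed_form :: "('a,'n::finite) chart set \<Rightarrow> nat \<Rightarrow> ('a,'n) form \<Rightarrow> bool" where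
  "closed_form A k \<omega> \<longleftrightarrow>
     (\<forall>c\<in>A. \<forall>x\<in>chart_image c. \<forall>vs. length vs = Suc k \<longrightarrow> exterior_derivative \<omega> c x vs = 0)"

definition nowhere_vanishing :: "('a,'n::finite) chart set \<Rightarrow> nat \<Rightarrow> ('a,'n) form \<Rightarrow> bool" where
  "nowhere_vanishing A k \<omega> \<longleftrightarrow>
     (\<forall>c\<in>A. \<forall>x\<in>chart_image c. \<exists>vs. length vs = k \<and> \<omega> c x vs \<noteq> 0)"


section \<open>Norm and Hodge star\<close>

definition gram :: "('a,'n::finite) metric \<Rightarrow> ('a,'n) chart \<Rightarrow> real^'n \<Rightarrow> real^'n^'n" where
  "gram g c x = (\<chi> i j. g c x (axis i 1) (axis j 1))"

text \<open>The product of the entries \<open>I ! a\<close>, \<open>J ! a\<close> of the inverse Gram matrix, i.e. the induced product on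
  covariant tensors, before antisymmetrization, of \<open>dx\<^sup>I\<close> and \<open>dx\<^sup>J\<close>.\<close>

definition inverse_gram_prod ::
    "('a,'n::finite) metric \<Rightarrow> ('a,'n) chart \<Rightarrow> real^'n \<Rightarrow> 'n list \<Rightarrow> 'n list \<Rightarrow> real" where
  "inverse_gram_prod g c x I J = (\<Prod>a<length I. matrix_inv (gram g c x) $ (I ! a) $ (J ! a))"

definition frame :: "'n::finite list \<Rightarrow> (real^'n) list" where
  "frame I = map (\<lambda>i. axis i 1) I"

text \<open>The sums below run over all multi-indices, not only the increasing ones, hence the factor
  \<open>1/k!\<close>; the products \<open>e\<^sup>I\<close> (\<open>I\<close> increasing) of an orthonormal coframe have norm 1.\<close>

definition form_norm ::
    "('a,'n::finite) metric \<Rightarrow> nat \<Rightarrow> ('a,'n) form \<Rightarrow> ('a,'n) chart \<Rightarrow> real^'n \<Rightarrow> real" where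
  "form_norm g k \<omega> c x = sqrt (1 / fact k *
     (\<Sum>I | length I = k. \<Sum>J | length J = k.
        inverse_gram_prod g c x I J * \<omega> c x (frame I) * \<omega> c x (frame J)))"

text \<open>The Riemannian volume form; \<open>card {..<j}\<close> is the position of \<open>j\<close> in the index type, so
  the matrix has the arguments \<open>vs\<close> as its columns.\<close>

definition volume_form :: "('a,'n::{finite,wellorder}) metric \<Rightarrow> ('a,'n) form" where
  "volume_form g c x vs = sqrt (det (gram g c x)) * det (\<chi> i j. (vs ! card {..<j}) $ i)"

text \<open>Contraction of a \<open>k\<close>-form with the first \<open>k\<close> arguments of the volume form. This is the
  convention \<open>\<alpha> \<and> \<star>\<omega> = \<langle>\<alpha>,\<omega>\<rangle> vol\<close>: for a positively oriented orthonormal frame \<open>e\<close>,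
  \<open>(\<star>\<omega>)(v) = \<Sum>I. \<omega>(e\<^sub>I) vol(e\<^sub>I, v)\<close> over increasing \<open>I\<close>.\<close>

definition hodge_star :: "('a,'n::{finite,wellorder}) metric \<Rightarrow> nat \<Rightarrow> ('a,'n) form \<Rightarrow> ('a,'n) form"
  where
  "hodge_star g k \<omega> c x vs = 1 / fact k *
     (\<Sum>I | length I = k. \<Sum>J | length J = k.
        inverse_gram_prod g c x I J * \<omega> c x (frame I) * volume_form g c x (frame J @ vs))"


section \<open>Flux forms, harmonic and eikonal forms\<close>

definition flux_form :: "('a,'n::finite) chart set \<Rightarrow> ('a,'n) form \<Rightarrow> bool" where
  "flux_form A \<beta> \<longleftrightarrow> \<beta> \<in> k_forms A (CARD('n) - 1) \<and> closed_form A (CARD('n) - 1) \<beta>"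

definition harmonic ::
    "('a,'n::{finite,wellorder}) chart set \<Rightarrow> ('a,'n) metric \<Rightarrow> ('a,'n) form \<Rightarrow> bool" where
  "harmonic A g \<beta> \<longleftrightarrow> flux_form A \<beta> \<and> closed_form A 1 (hodge_star g (CARD('n) - 1) \<beta>)"

definition normalization ::
    "('a,'n::finite) chart set \<Rightarrow> ('a,'n) metric \<Rightarrow> nat \<Rightarrow> ('a,'n) form \<Rightarrow> ('a,'n) form \<Rightarrow> bool"
  where
  "normalization A g k \<alpha> \<xi> \<longleftrightarrow> \<xi> \<in> k_forms A k \<and>
     (\<forall>c\<in>A. \<forall>x\<in>chart_image c.
        (\<forall>vs. length vs = k \<longrightarrow> form_norm g k \<alpha> c x * \<xi> c x vs = \<alpha> c x vs) \<and>
        form_norm g k \<xi> c x \<le> 1)"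

definition eikonal ::
    "('a,'n::{finite,wellorder}) chart set \<Rightarrow> ('a,'n) metric \<Rightarrow> ('a,'n) form \<Rightarrow> bool" where
  "eikonal A g \<beta> \<longleftrightarrow> flux_form A \<beta> \<and>
     (\<exists>\<eta>. normalization A g 1 (hodge_star g (CARD('n) - 1) \<beta>) \<eta> \<and> closed_form A 1 \<eta>)"

end

theory Submission
  imports Defs
begin

text \<open>
  Write \<open>n\<close> for the dimension. Under \<open>h' = \<phi>\<^sup>2 h\<close> the Hodge star of an \<open>(n-1)\<close>-form is divided by
  \<open>\<phi>\<^sup>n\<^sup>-\<^sup>2\<close> and the norm of a 1-form by \<open>\<phi>\<close> (\<open>hodge_star_hyperform_rescaled\<close>, \<open>form_norm_rescaled\<close>). Hence
  \<open>\<star>\<beta>\<close> is the same for all metrics of the conformal class up to a positive factor. Both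
  conditions of the theorem say that some positive multiple of \<open>\<star>\<beta>\<close> is closed, and the conformal factor
  is free to adjust the multiple.

  If \<open>\<alpha> = \<star>\<beta>\<close> is closed for \<open>h\<close>, then \<open>\<alpha>\<close> has norm 1 for \<open>\<bar>\<alpha>\<bar>\<^sup>2 h\<close>, and so it is a closed normalization
  of the star of \<open>\<beta>\<close> taken in this metric (\<open>harmonic_imp_eikonal\<close>). Conversely, a closed normalization
  \<open>\<eta>\<close> for \<open>h\<close> equals \<open>\<star>\<beta> / \<bar>\<star>\<beta>\<bar>\<close>, and this is the star of \<open>\<beta>\<close> for \<open>\<phi>\<^sup>2 h\<close> with
  \<open>\<phi>\<^sup>n\<^sup>-\<^sup>2 = \<bar>\<star>\<beta>\<bar>\<close>, which can be solved because \<open>n \<ge> 3\<close> (\<open>eikonal_imp_harmonic\<close>).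

  What has to be established is that the factors are legitimate: \<open>\<bar>\<star>\<beta>\<bar>\<close> is a positive smooth function on
  the manifold. Positivity is the injectivity of the star (\<open>hodge_star_hyperform_nonzero\<close>). Independence
  of the chart, for the norm and for the star, rests on one transformation law for contractions of
  multilinear functions (\<open>contraction_map\<close>). Smoothness follows from Cramer's rule for the inverse Gram
  matrix and from closure properties of the class of smooth functions.
\<close>

section \<open>Smooth functions on subsets\<close>

lemma Ck_on_subset: "Ck_on k W f \<Longrightarrow> V \<subseteq> W \<Longrightarrow> Ck_on k V f"
proof (induction k arbitrary: f)
  case 0
  then show ?case by (simp add: continuous_on_subset)
next
  case (Suc k)
  then show ?case by (simp add: subset_iff)
qed

lemma frechet_derivative_eq: "(f has_derivative f') (at x) \<Longrightarrow> frechet_derivative f (at x) = f'"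
  using frechet_derivative_at by metis

lemma frechet_derivative_cong_open:
  assumes "open W" "x \<in> W" "\<And>y. y \<in> W \<Longrightarrow> f y = g y"
  shows "frechet_derivative f (at x) = frechet_derivative g (at x)"
proof -
  have "(f has_derivative D) (at x) \<longleftrightarrow> (g has_derivative D) (at x)" for D
    using has_derivative_transform_within_open[OF _ assms(1,2)] assms(3) by metis
  then show ?thesis by (simp add: frechet_derivative_def)
qed

lemma Ck_on_cong:
  assumes "open W" "\<And>y. y \<in> W \<Longrightarrow> f y = g y" "Ck_on k W f"
  shows "Ck_on k W g"
  using assms(2,3)
proof (induction k arbitrary: f g)
  case 0
  then show ?case using continuous_on_cong by force
next
  case (Suc k)
  have "g differentiable (at x)" if "x \<in> W" for x
    using Suc.prems that has_derivative_transform_within_open[OF _ assms(1) that]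
    unfolding Ck_on.simps differentiable_def by metis
  moreover have "Ck_on k W (\<lambda>x. frechet_derivative g (at x) v)" for v
  proof (rule Suc.IH)
    show "Ck_on k W (\<lambda>x. frechet_derivative f (at x) v)"
      using Suc.prems by simp
    show "frechet_derivative f (at y) v = frechet_derivative g (at y) v" if "y \<in> W" for y
      using frechet_derivative_cong_open[OF assms(1) that] Suc.prems(1) by metis
  qed
  ultimately show ?case by simp
qed

lemma Ck_on_Suc_imp: "Ck_on (Suc k) W f \<Longrightarrow> Ck_on k W f"
proof (induction k arbitrary: f)
  case 0
  then show ?case
    by (auto intro!: continuous_at_imp_continuous_on differentiable_imp_continuous_within)
next
  case (Suc k)
  then show ?case by (metis Ck_on.simps(2))
qed

text \<open>Any family of derivatives will do here, so that sums, products and compositions can use the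
  usual rules of differentiation instead of the choice made by \<^const>\<open>frechet_derivative\<close>.\<close>

lemma Ck_on_SucI:
  assumes "open W" "\<And>x. x \<in> W \<Longrightarrow> (f has_derivative f' x) (at x)"
    "\<And>v. Ck_on k W (\<lambda>x. f' x v)"
  shows "Ck_on (Suc k) W f"
proof -
  have "Ck_on k W (\<lambda>x. frechet_derivative f (at x) v)" for v
    by (rule Ck_on_cong[OF assms(1) _ assms(3)[of v]])
      (simp add: frechet_derivative_eq[OF assms(2)])
  then show ?thesis using assms(2) by (auto simp: differentiable_def)
qed

lemma Ck_on_SucD:
  assumes "Ck_on (Suc k) W f" "x \<in> W"
  shows "(f has_derivative frechet_derivative f (at x)) (at x)"
  using assms frechet_derivative_works by auto

lemma Ck_on_const: "open W \<Longrightarrow> Ck_on k W (\<lambda>x. c)"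
proof (induction k arbitrary: c)
  case (Suc k)
  then show ?case by (intro Ck_on_SucI[where f' = "\<lambda>_ _. 0"]) auto
qed simp

lemma Ck_on_add:
  assumes "open W"
  shows "Ck_on k W f \<Longrightarrow> Ck_on k W g \<Longrightarrow> Ck_on k W (\<lambda>x. f x + g x)"
proof (induction k arbitrary: f g)
  case 0
  then show ?case by (simp add: continuous_on_add)
next
  case (Suc k)
  show ?case
    by (rule Ck_on_SucI[OF assms has_derivative_add[OF Ck_on_SucD[OF Suc.prems(1)]
          Ck_on_SucD[OF Suc.prems(2)]]])
      (use Suc in auto)
qed

lemma Ck_on_mult:
  fixes f g :: "'a::real_normed_vector \<Rightarrow> real"
  assumes "open W"
  shows "Ck_on k W f \<Longrightarrow> Ck_on k W g \<Longrightarrow> Ck_on k W (\<lambda>x. f x * g x)"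
proof (induction k arbitrary: f g)
  case 0
  then show ?case by (simp add: continuous_on_mult)
next
  case (Suc k)
  show ?case
    by (rule Ck_on_SucI[OF assms has_derivative_mult[OF Ck_on_SucD[OF Suc.prems(1)]
          Ck_on_SucD[OF Suc.prems(2)]]])
      (use Suc Ck_on_Suc_imp[OF Suc.prems(1)] Ck_on_Suc_imp[OF Suc.prems(2)]
        in \<open>auto intro!: Ck_on_add[OF assms]\<close>)
qed

text \<open>A smooth function of one variable enters as the sequence of its derivatives. The induction on
  the order of differentiability then runs over all members of the sequence at once, since the chain
  rule for one member produces the next.\<close>

lemma Ck_on_compose_real:
  fixes f :: "'a::real_normed_vector \<Rightarrow> real" and \<phi> :: "nat \<Rightarrow> real \<Rightarrow> real"
  assumes "open W" "\<And>j t. t \<in> T \<Longrightarrow> (\<phi> j has_real_derivative \<phi> (Suc j) t) (at t)"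
    and "f ` W \<subseteq> T" "Ck_on k W f"
  shows "Ck_on k W (\<lambda>x. \<phi> j (f x))"
  using assms(4)
proof (induction k arbitrary: j)
  case 0
  have "continuous_on T (\<phi> j)"
    using assms(2) by (meson DERIV_isCont continuous_at_imp_continuous_on)
  then show ?case
    using 0 assms(3) continuous_on_compose2 by (auto simp: image_subset_iff)
next
  case (Suc k)
  let ?D = "\<lambda>x v. frechet_derivative f (at x) v * \<phi> (Suc j) (f x)"
  have "((\<lambda>x. \<phi> j (f x)) has_derivative ?D x) (at x)" if "x \<in> W" for x
    using has_derivative_compose[OF Ck_on_SucD[OF Suc.prems that]
        assms(2)[of "f x" j, unfolded has_field_derivative_def]] that assms(3)
    by (auto simp: mult.commute)
  moreover have "Ck_on k W (\<lambda>x. ?D x v)" for v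
    using Suc.prems Suc.IH[OF Ck_on_Suc_imp[OF Suc.prems]] by (intro Ck_on_mult[OF assms(1)]) auto
  ultimately show ?case by (rule Ck_on_SucI[OF assms(1)])
qed

lemma smooth_onI:
  assumes "\<And>x. x \<in> S \<Longrightarrow>
    \<exists>W F. open W \<and> x \<in> W \<and> (\<forall>k. Ck_on k W F) \<and> (\<forall>y\<in>S \<inter> W. F y = f y)"
  shows "smooth_on S f"
  using assms by (simp add: smooth_on_def)

lemma smooth_on_cong: "(\<And>x. x \<in> S \<Longrightarrow> f x = g x) \<Longrightarrow> smooth_on S f \<longleftrightarrow> smooth_on S g"
  by (simp add: smooth_on_def)

lemma smooth_on_const: "smooth_on S (\<lambda>x. c)"
  by (rule smooth_onI) (use Ck_on_const in blast)

text \<open>Two local extensions are combined on the intersection of their domains.\<close>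

lemma smooth_on_combine:
  fixes f :: "'a::real_normed_vector \<Rightarrow> 'b::real_normed_vector"
    and g :: "'a \<Rightarrow> 'c::real_normed_vector" and op :: "'b \<Rightarrow> 'c \<Rightarrow> 'd::real_normed_vector"
  assumes "\<And>k (W :: 'a set) F G. open W \<Longrightarrow> Ck_on k W F \<Longrightarrow> Ck_on k W G \<Longrightarrow> Ck_on k W (\<lambda>x. op (F x) (G x))"
    and "smooth_on S f" "smooth_on S g"
  shows "smooth_on S (\<lambda>x. op (f x) (g x))"
proof (rule smooth_onI)
  fix x assume "x \<in> S"
  then obtain V F W G where
    "open V" "x \<in> V" "\<forall>k. Ck_on k V F" "\<forall>y\<in>S \<inter> V. F y = f y" and
    "open W" "x \<in> W" "\<forall>k. Ck_on k W G" "\<forall>y\<in>S \<inter> W. G y = g y"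
    using assms(2,3) unfolding smooth_on_def by metis
  moreover from this have "Ck_on k (V \<inter> W) (\<lambda>x. op (F x) (G x))" for k
    by (intro assms(1) open_Int) (auto intro: Ck_on_subset)
  ultimately show "\<exists>W H. open W \<and> x \<in> W \<and> (\<forall>k. Ck_on k W H) \<and>
      (\<forall>y\<in>S \<inter> W. H y = op (f y) (g y))"
    by (intro exI[of _ "V \<inter> W"] exI[of _ "\<lambda>x. op (F x) (G x)"]) auto
qed

lemma smooth_on_add: "smooth_on S f \<Longrightarrow> smooth_on S g \<Longrightarrow> smooth_on S (\<lambda>x. f x + g x)"
  by (rule smooth_on_combine[OF Ck_on_add])

lemma smooth_on_mult:
  "smooth_on S f \<Longrightarrow> smooth_on S g \<Longrightarrow> smooth_on S (\<lambda>x. f x * g x :: real)"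
  by (rule smooth_on_combine[OF Ck_on_mult])

lemma smooth_on_sum: "(\<And>i. i \<in> I \<Longrightarrow> smooth_on S (f i)) \<Longrightarrow> smooth_on S (\<lambda>x. \<Sum>i\<in>I. f i x)"
  by (induction I rule: infinite_finite_induct) (auto intro: smooth_on_const smooth_on_add)

lemma smooth_on_prod:
  fixes f :: "'i \<Rightarrow> 'a::real_normed_vector \<Rightarrow> real"
  shows "(\<And>i. i \<in> I \<Longrightarrow> smooth_on S (f i)) \<Longrightarrow> smooth_on S (\<lambda>x. \<Prod>i\<in>I. f i x)"
  by (induction I rule: infinite_finite_induct) (auto intro: smooth_on_const smooth_on_mult)

text \<open>The values lie in the open set \<open>T\<close> only on \<open>S\<close>; the extension of \<open>f\<close> may leave it and has to be
  restricted to the preimage of \<open>T\<close>.\<close>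

lemma smooth_on_compose_real:
  fixes f :: "'a::real_normed_vector \<Rightarrow> real" and \<phi> :: "nat \<Rightarrow> real \<Rightarrow> real"
  assumes "open T" "\<And>j t. t \<in> T \<Longrightarrow> (\<phi> j has_real_derivative \<phi> (Suc j) t) (at t)"
    and "f ` S \<subseteq> T" "smooth_on S f"
  shows "smooth_on S (\<lambda>x. \<phi> 0 (f x))"
proof (rule smooth_onI)
  fix x assume x: "x \<in> S"
  then obtain W F where W: "open W" "x \<in> W" "\<forall>k. Ck_on k W F" "\<forall>y\<in>S \<inter> W. F y = f y"
    using assms(4) unfolding smooth_on_def by metis
  define V where "V = F -` T \<inter> W"
  have "continuous_on W F" using W(3)[rule_format, of 0] by simp
  then have "open V"
    unfolding V_def using continuous_open_preimage[OF _ W(1) assms(1)] by (simp add: Int_commute)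
  moreover have "x \<in> V" using x W assms(3) by (auto simp: V_def image_subset_iff)
  moreover have "Ck_on k V (\<lambda>x. \<phi> 0 (F x))" for k
    by (rule Ck_on_compose_real[where \<phi> = \<phi> and T = T, OF \<open>open V\<close> assms(2)])
      (use W(3) in \<open>auto simp: V_def intro: Ck_on_subset\<close>)
  ultimately show "\<exists>W H. open W \<and> x \<in> W \<and> (\<forall>k. Ck_on k W H) \<and> (\<forall>y\<in>S \<inter> W. H y = \<phi> 0 (f y))"
    using W(4) by (intro exI[of _ V] exI[of _ "\<lambda>x. \<phi> 0 (F x)"]) (auto simp: V_def)
qed

text \<open>This one family gives smoothness of quotients, square roots and,
  through the derivative \<open>t powr (-1)\<close>, of logarithms.\<close>

fun powr_derivs :: "real \<Rightarrow> nat \<Rightarrow> real \<Rightarrow> real" where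
  "powr_derivs a 0 t = t powr a"
| "powr_derivs a (Suc j) t = a * powr_derivs (a - 1) j t"

lemma powr_derivs_deriv:
  "t > 0 \<Longrightarrow> (powr_derivs a j has_real_derivative powr_derivs a (Suc j) t) (at t)"
proof (induction j arbitrary: a)
  case 0
  then show ?case
    using has_real_derivative_powr[of t a] by (simp add: fun_eq_iff)
next
  case (Suc j)
  have "((\<lambda>t. a * powr_derivs (a - 1) j t) has_real_derivative
      a * powr_derivs (a - 1) (Suc j) t) (at t)"
    by (rule DERIV_cmult[OF Suc.IH[OF Suc.prems]])
  then show ?case by (simp add: fun_eq_iff)
qed

lemma smooth_on_powr:
  fixes f :: "'a::real_normed_vector \<Rightarrow> real"
  assumes "smooth_on S f" "\<And>x. x \<in> S \<Longrightarrow> 0 < f x"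
  shows "smooth_on S (\<lambda>x. f x powr a)"
  using smooth_on_compose_real[of "{0<..}" "powr_derivs a", OF _ powr_derivs_deriv _ assms(1)]
    assms(2) by auto

lemma smooth_on_ln:
  fixes f :: "'a::real_normed_vector \<Rightarrow> real"
  assumes "smooth_on S f" "\<And>x. x \<in> S \<Longrightarrow> 0 < f x"
  shows "smooth_on S (\<lambda>x. ln (f x))"
proof -
  let ?\<phi> = "\<lambda>j. case j of 0 \<Rightarrow> ln | Suc i \<Rightarrow> powr_derivs (-1) i"
  have "(?\<phi> j has_real_derivative ?\<phi> (Suc j) t) (at t)" if "t \<in> {0<..}" for j and t :: real
  proof (cases j)
    case 0
    then show ?thesis
      using that DERIV_ln[of t] by (simp add: powr_minus)
  next
    case (Suc i)
    then show ?thesis using that powr_derivs_deriv[of t "-1" i] by simp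
  qed
  from smooth_on_compose_real[where \<phi> = ?\<phi>, OF open_greaterThan this _ assms(1)] show ?thesis
    using assms(2) by (auto simp: image_subset_iff)
qed

lemma smooth_on_sqrt:
  fixes f :: "'a::real_normed_vector \<Rightarrow> real"
  assumes "smooth_on S f" "\<And>x. x \<in> S \<Longrightarrow> 0 < f x"
  shows "smooth_on S (\<lambda>x. sqrt (f x))"
  using smooth_on_powr[OF assms, of "1/2"] assms(2)
  by (subst smooth_on_cong[where g = "\<lambda>x. f x powr (1/2)"]) (auto simp: powr_half_sqrt less_imp_le)

lemma smooth_on_divide:
  fixes f g :: "'a::real_normed_vector \<Rightarrow> real"
  assumes "smooth_on S f" "smooth_on S g" "\<And>x. x \<in> S \<Longrightarrow> 0 < g x"
  shows "smooth_on S (\<lambda>x. f x / g x)"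
  using smooth_on_mult[OF assms(1) smooth_on_powr[OF assms(2,3), of "-1"]] assms(3)
  by (subst smooth_on_cong[where g = "\<lambda>x. f x * g x powr (-1)"])
    (auto simp: powr_minus divide_inverse less_imp_le)

lemma smooth_on_det:
  fixes B :: "'a::real_normed_vector \<Rightarrow> real^'n^'n"
  assumes "\<And>i j. smooth_on S (\<lambda>x. B x $ i $ j)"
  shows "smooth_on S (\<lambda>x. det (B x))"
  unfolding det_def
  by (intro smooth_on_sum smooth_on_mult smooth_on_prod smooth_on_const assms)

lemma matrix_inv_inverse:
  fixes B :: "real^'n^'n"
  assumes "invertible B"
  shows "B ** matrix_inv B = mat 1" "matrix_inv B ** B = mat 1"
  using someI_ex[OF assms[unfolded invertible_def]] by (auto simp: matrix_inv_def)

lemma matrix_inv_eqI: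
  fixes B :: "real^'n^'n"
  assumes "C ** B = mat 1"
  shows "matrix_inv B = C"
proof -
  have "invertible B" using assms invertible_left_inverse by blast
  then show ?thesis
    by (metis assms matrix_inv_inverse(1) matrix_mul_assoc matrix_mul_lid matrix_mul_rid)
qed

text \<open>Cramer's rule expresses the entries of the inverse as quotients of determinants, which are
  polynomials in the entries.\<close>

lemma smooth_on_matrix_inv:
  fixes B :: "'a::real_normed_vector \<Rightarrow> real^'n^'n"
  assumes "\<And>i j. smooth_on S (\<lambda>x. B x $ i $ j)" "\<And>x. x \<in> S \<Longrightarrow> 0 < det (B x)"
  shows "smooth_on S (\<lambda>x. matrix_inv (B x) $ i $ j)"
proof -
  let ?C = "\<lambda>x. (\<chi> p q. if q = i then axis j 1 $ p else B x $ p $ q) :: real^'n^'n"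
  have "smooth_on S (\<lambda>x. ?C x $ p $ q)" for p q
    using assms(1) by (cases "q = i") (auto intro: smooth_on_const)
  note C = smooth_on_det[OF this]
  have "matrix_inv (B x) $ i $ j = det (?C x) / det (B x)" if "x \<in> S" for x
  proof -
    have "invertible (B x)" using assms(2)[OF that] by (simp add: invertible_det_nz)
    then have "B x *v (matrix_inv (B x) *v axis j 1) = axis j 1"
      by (simp add: matrix_vector_mul_assoc matrix_inv_inverse)
    then have "matrix_inv (B x) *v axis j 1
        = (\<chi> k. det (\<chi> p q. if q = k then axis j 1 $ p else B x $ p $ q) / det (B x))"
      using cramer[of "B x"] assms(2)[OF that] by fastforce
    from arg_cong[OF this, of "\<lambda>v. v $ i"] show ?thesis
      by (simp add: matrix_vector_mult_basis column_def)
  qed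
  moreover have "smooth_on S (\<lambda>x. det (?C x) / det (B x))"
    by (intro smooth_on_divide C smooth_on_det assms)
  ultimately show ?thesis by (subst smooth_on_cong) auto
qed

section \<open>Contraction of multilinear functions\<close>

text \<open>The pairing of two covariant tensors, both with \<open>k\<close> arguments, by means of the bilinear form \<open>Q\<close>
  on covectors. With the inverse Gram matrix as \<open>Q\<close> it underlies both the norm and the Hodge star: for
  the latter, \<open>H\<close> is the volume form with its last arguments fixed.\<close>

definition contraction ::
    "real^'n^'n \<Rightarrow> nat \<Rightarrow> ((real^'n) list \<Rightarrow> real) \<Rightarrow> ((real^'n) list \<Rightarrow> real) \<Rightarrow> real" where
  "contraction Q k F H = (\<Sum>I | length I = k. \<Sum>J | length J = k.
     (\<Prod>a<k. Q $ (I ! a) $ (J ! a)) * F (frame I) * H (frame J))"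

definition multilinear :: "nat \<Rightarrow> ((real^'n) list \<Rightarrow> real) \<Rightarrow> bool" where
  "multilinear k F \<longleftrightarrow> (\<forall>vs. length vs = k \<longrightarrow> (\<forall>i<k. linear (\<lambda>v. F (vs[i := v]))))"

lemma alternating_imp_multilinear: "alternating_multilinear k F \<Longrightarrow> multilinear k F"
  by (simp add: alternating_multilinear_def multilinear_def)

lemma multilinear_Cons:
  assumes "multilinear (Suc k) F"
  shows "multilinear k (\<lambda>vs. F (v # vs))"
  unfolding multilinear_def
proof (intro allI impI)
  fix vs :: "(real^'a) list" and i assume "length vs = k" "i < k"
  then show "linear (\<lambda>w. F (v # vs[i := w]))"
    using assms[unfolded multilinear_def, rule_format, of "v # vs" "Suc i"] by simp
qed

lemma multilinear_linear_head:
  assumes "multilinear (Suc k) F" "length vs = k"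
  shows "linear (\<lambda>v. F (v # vs))"
  using assms(1)[unfolded multilinear_def, rule_format, of "0 # vs" 0] assms(2) by simp

lemma length_frame [simp]: "length (frame I) = length I"
  by (simp add: frame_def)

lemma frame_Cons: "frame (i # I) = axis i 1 # frame I"
  by (simp add: frame_def)

lemma finite_multi_indices [simp]: "finite {I :: 'n::finite list. length I = k}"
  using finite_lists_length_eq[of "UNIV :: 'n set" k] by simp

lemma sum_multi_indices_Suc:
  "(\<Sum>I :: 'n::finite list | length I = Suc k. f I)
    = (\<Sum>i\<in>UNIV. \<Sum>I | length I = k. f (i # I))"
proof -
  have eq: "{I :: 'n list. length I = Suc k} = (\<lambda>(i, I). i # I) ` (UNIV \<times> {I. length I = k})"
    by (auto simp: length_Suc_conv image_iff)
  have "(\<Sum>I :: 'n list | length I = Suc k. f I)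
      = (\<Sum>(i, I)\<in>UNIV \<times> {I. length I = k}. f (i # I))"
    unfolding eq by (subst sum.reindex) (auto simp: inj_on_def case_prod_unfold)
  then show ?thesis by (simp add: sum.cartesian_product)
qed

lemma contraction_Suc:
  fixes Q :: "real^'n^'n"
  shows "contraction Q (Suc k) F H = (\<Sum>i\<in>UNIV. \<Sum>j\<in>UNIV. Q $ i $ j *
     contraction Q k (\<lambda>vs. F (axis i 1 # vs)) (\<lambda>vs. H (axis j 1 # vs)))"
proof -
  let ?S = "{I :: 'n list. length I = k}"
  have "contraction Q (Suc k) F H = (\<Sum>i\<in>UNIV. \<Sum>I\<in>?S. \<Sum>j\<in>UNIV. \<Sum>J\<in>?S. Q $ i $ j *
      ((\<Prod>a<k. Q $ (I ! a) $ (J ! a)) * F (axis i 1 # frame I) * H (axis j 1 # frame J)))"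
    unfolding contraction_def sum_multi_indices_Suc
    by (simp add: prod.lessThan_Suc_shift frame_Cons mult.assoc del: prod.lessThan_Suc)
  also have "\<dots> = (\<Sum>i\<in>UNIV. \<Sum>j\<in>UNIV. Q $ i $ j *
     contraction Q k (\<lambda>vs. F (axis i 1 # vs)) (\<lambda>vs. H (axis j 1 # vs)))"
    by (subst sum.swap) (simp add: contraction_def sum_distrib_left)
  finally show ?thesis .
qed

lemma contraction_cong:
  assumes "\<And>vs. length vs = k \<Longrightarrow> F vs = F' vs" "\<And>vs. length vs = k \<Longrightarrow> H vs = H' vs"
  shows "contraction Q k F H = contraction Q k F' H'"
  unfolding contraction_def by (intro sum.cong refl) (simp add: assms)

lemma contraction_scale:
  "contraction (s *\<^sub>R Q) k (\<lambda>vs. a * F vs) (\<lambda>vs. b * H vs) = s ^ k * a * b * contraction Q k F H"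
  unfolding contraction_def by (simp add: prod.distrib sum_distrib_left mult_ac)

lemma contraction_sum:
  fixes Q :: "real^'n^'n"
  assumes "finite S" "finite T"
  shows "contraction Q k (\<lambda>vs. \<Sum>p\<in>S. a p * F p vs) (\<lambda>vs. \<Sum>q\<in>T. b q * H q vs)
    = (\<Sum>p\<in>S. \<Sum>q\<in>T. a p * b q * contraction Q k (F p) (H q))"
proof -
  let ?L = "{I :: 'n list. length I = k}"
  have "contraction Q k (\<lambda>vs. \<Sum>p\<in>S. a p * F p vs) (\<lambda>vs. \<Sum>q\<in>T. b q * H q vs)
     = (\<Sum>I\<in>?L. \<Sum>J\<in>?L. \<Sum>p\<in>S. \<Sum>q\<in>T. a p * b q * ((\<Prod>a<k. Q $ (I ! a) $ (J ! a)) *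
          F p (frame I) * H q (frame J)))"
    unfolding contraction_def by (simp add: sum_distrib_left sum_distrib_right mult_ac)
  also have "\<dots> = (\<Sum>I\<in>?L. \<Sum>p\<in>S. \<Sum>J\<in>?L. \<Sum>q\<in>T. a p * b q * ((\<Prod>a<k. Q $ (I ! a) $ (J ! a)) *
          F p (frame I) * H q (frame J)))"
    by (intro sum.cong refl sum.swap)
  also have "\<dots> = (\<Sum>p\<in>S. \<Sum>I\<in>?L. \<Sum>q\<in>T. \<Sum>J\<in>?L. a p * b q * ((\<Prod>a<k. Q $ (I ! a) $ (J ! a)) *
          F p (frame I) * H q (frame J)))"
    by (subst sum.swap, intro sum.cong refl sum.swap)
  also have "\<dots> = (\<Sum>p\<in>S. \<Sum>q\<in>T. \<Sum>I\<in>?L. \<Sum>J\<in>?L. a p * b q * ((\<Prod>a<k. Q $ (I ! a) $ (J ! a)) *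
          F p (frame I) * H q (frame J)))"
    by (intro sum.cong refl sum.swap)
  finally show ?thesis by (simp add: contraction_def sum_distrib_left)
qed

lemma axis_expansion: "(v :: real^'n) = (\<Sum>i\<in>UNIV. v $ i *\<^sub>R axis i 1)"
  by (simp add: vec_eq_iff axis_def if_distrib cong: if_cong)

lemma linear_matrix_expand:
  fixes f :: "real^'n \<Rightarrow> real" and A :: "real^'n^'n"
  assumes "linear f"
  shows "f (A *v axis i 1) = (\<Sum>p\<in>UNIV. A $ p $ i * f (axis p 1))"
proof -
  have "A *v axis i 1 = (\<Sum>p\<in>UNIV. A $ p $ i *\<^sub>R axis p 1)"
    by (simp add: matrix_vector_mult_basis vec_eq_iff)
      (simp add: column_def axis_def if_distrib cong: if_cong)
  then show ?thesis
    by (simp add: linear_sum[OF assms] linear_cmul[OF assms])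
qed

text \<open>The law behind the behaviour of norm and Hodge star under linear maps. With \<open>A = B\<close>
  the derivative of a coordinate change it gives their invariance; with \<open>Q = B = 1\<close> it moves a matrix
  from the pairing into one of the tensors, that is, it raises indices. The proof splits off one argument at a time.\<close>

lemma contraction_map:
  fixes Q A B :: "real^'n^'n"
  assumes "multilinear k F" "multilinear k H"
  shows "contraction Q k (\<lambda>vs. F (map ((*v) A) vs)) (\<lambda>vs. H (map ((*v) B) vs))
    = contraction (A ** Q ** transpose B) k F H"
  using assms
proof (induction k arbitrary: F H)
  case 0
  then show ?case by (simp add: contraction_def frame_def)
next
  case (Suc k)
  let ?R = "A ** Q ** transpose B"
  let ?c = "\<lambda>p q. contraction ?R k (\<lambda>vs. F (axis p 1 # vs)) (\<lambda>vs. H (axis q 1 # vs))"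
  have entry: "?R $ p $ q = (\<Sum>i\<in>UNIV. \<Sum>j\<in>UNIV. Q $ i $ j * (A $ p $ i * B $ q $ j))" for p q
    unfolding matrix_matrix_mult_def transpose_def
    by (subst sum.swap) (simp add: sum_distrib_right sum_distrib_left mult_ac)
  have step: "contraction Q k (\<lambda>vs. F (A *v axis i 1 # map ((*v) A) vs))
        (\<lambda>vs. H (B *v axis j 1 # map ((*v) B) vs))
      = (\<Sum>p\<in>UNIV. \<Sum>q\<in>UNIV. A $ p $ i * B $ q $ j * ?c p q)" for i j
  proof -
    have "contraction Q k (\<lambda>vs. F (A *v axis i 1 # map ((*v) A) vs))
          (\<lambda>vs. H (B *v axis j 1 # map ((*v) B) vs))
        = contraction ?R k (\<lambda>vs. F (A *v axis i 1 # vs)) (\<lambda>vs. H (B *v axis j 1 # vs))"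
      by (intro Suc.IH multilinear_Cons Suc.prems)
    also have "\<dots> = contraction ?R k (\<lambda>vs. \<Sum>p\<in>UNIV. A $ p $ i * F (axis p 1 # vs))
        (\<lambda>vs. \<Sum>q\<in>UNIV. B $ q $ j * H (axis q 1 # vs))"
      by (intro contraction_cong linear_matrix_expand multilinear_linear_head[of k] Suc.prems)
    finally show ?thesis by (simp add: contraction_sum)
  qed
  have "contraction Q (Suc k) (\<lambda>vs. F (map ((*v) A) vs)) (\<lambda>vs. H (map ((*v) B) vs))
      = (\<Sum>i\<in>UNIV. \<Sum>j\<in>UNIV. \<Sum>p\<in>UNIV. \<Sum>q\<in>UNIV. Q $ i $ j * (A $ p $ i * B $ q $ j) * ?c p q)"
    by (simp add: contraction_Suc step sum_distrib_left mult.assoc)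
  also have "\<dots> = (\<Sum>i\<in>UNIV. \<Sum>p\<in>UNIV. \<Sum>j\<in>UNIV. \<Sum>q\<in>UNIV. Q $ i $ j * (A $ p $ i * B $ q $ j) * ?c p q)"
    by (intro sum.cong refl sum.swap)
  also have "\<dots> = (\<Sum>p\<in>UNIV. \<Sum>i\<in>UNIV. \<Sum>q\<in>UNIV. \<Sum>j\<in>UNIV. Q $ i $ j * (A $ p $ i * B $ q $ j) * ?c p q)"
    by (subst sum.swap, intro sum.cong refl sum.swap)
  also have "\<dots> = (\<Sum>p\<in>UNIV. \<Sum>q\<in>UNIV. \<Sum>i\<in>UNIV. \<Sum>j\<in>UNIV. Q $ i $ j * (A $ p $ i * B $ q $ j) * ?c p q)"
    by (intro sum.cong refl sum.swap)
  also have "\<dots> = contraction ?R (Suc k) F H"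
    by (simp add: contraction_Suc entry sum_distrib_right)
  finally show ?case .
qed

lemma multilinear_zero_on_frames:
  assumes "multilinear k F" "\<And>I. length I = k \<Longrightarrow> F (frame I) = 0" "length vs = k"
  shows "F vs = 0"
  using assms
proof (induction k arbitrary: F vs)
  case 0
  then show ?case by (simp add: frame_def)
next
  case (Suc k)
  obtain v ws where vs: "vs = v # ws" "length ws = k"
    using Suc.prems(3) by (auto simp: length_Suc_conv)
  have lin: "linear (\<lambda>v. F (v # ws))" using multilinear_linear_head[OF Suc.prems(1) vs(2)] .
  have "F (axis i 1 # ws) = 0" for i
    by (rule Suc.IH[OF multilinear_Cons[OF Suc.prems(1)] _ vs(2)])
      (use Suc.prems(2)[of "i # _"] in \<open>simp add: frame_Cons\<close>)
  then show ?case
    using axis_expansion[of v] linear_sum[OF lin, of "\<lambda>i. v $ i *\<^sub>R axis i 1" UNIV] linear_cmul[OF lin] vs by simp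
qed

section \<open>Alternating functions and determinants\<close>

lemma alternating_swap:
  assumes F: "alternating_multilinear k F" and "length vs = k" "i < k" "j < k" "i \<noteq> j"
  shows "F (vs[i := vs ! j, j := vs ! i]) = - F vs"
proof -
  define G where "G a b = F (vs[i := a, j := b])" for a b
  have "linear (\<lambda>b. G a b)" for a
    using F assms(2-) by (simp add: G_def alternating_multilinear_def)
  then have add2: "G a (b + c) = G a b + G a c" for a b c by (rule linear_add)
  have "linear (\<lambda>a. G a b)" for b
    using F assms(2-) unfolding G_def alternating_multilinear_def
    by (subst list_update_swap) auto
  then have add1: "G (a + b) c = G a c + G b c" for a b c by (rule linear_add)
  have diag: "G a a = 0" for a
    using F assms(2-) by (auto simp: G_def alternating_multilinear_def)
  \<comment> \<open>polarization: expand the value at equal arguments\<close>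
  have "G (vs ! i + vs ! j) (vs ! i + vs ! j) = 0" by (rule diag)
  then have "G (vs ! i) (vs ! j) + G (vs ! j) (vs ! i) = 0"
    unfolding add1 add2 by (simp add: diag)
  then show ?thesis by (simp add: G_def)
qed

text \<open>A permutation multiplies both factors by its sign, and the two signs cancel.\<close>

lemma alternating_prod_permutation:
  assumes F: "alternating_multilinear k F" and H: "alternating_multilinear k H"
    and "length vs = k" "mset ws = mset vs"
  shows "F ws * H ws = F vs * H vs"
proof -
  obtain p where p: "p permutes {..<k}" "permute_list p vs = ws"
    using mset_eq_permutation[OF assms(4)] assms(3) by auto
  have "finite {..<k}" by simp
  from this p(1) have "F (permute_list p vs) * H (permute_list p vs) = F vs * H vs"
  proof (induction rule: permutes_rev_induct)
    case id
    then show ?case by simp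
  next
    case (swap a b p)
    let ?w = "permute_list p vs"
    have len: "length ?w = k" using assms(3) by simp
    have eq: "permute_list (p \<circ> Transposition.transpose a b) vs = ?w[a := ?w ! b, b := ?w ! a]"
      using swap assms(3) permutes_in_image[OF \<open>p permutes {..<k}\<close>]
      by (intro nth_equalityI)
        (auto simp: permute_list_def Transposition.transpose_def nth_list_update)
    show ?case
      unfolding eq using swap.hyps swap.IH alternating_swap[OF F len, of a b]
        alternating_swap[OF H len, of a b] by simp
  qed
  then show ?thesis using p by simp
qed

lemma alternating_append:
  assumes F: "alternating_multilinear (k + length ws) F"
  shows "alternating_multilinear k (\<lambda>vs. F (vs @ ws))"
  unfolding alternating_multilinear_def
proof (intro allI impI conjI)
  fix vs :: "(real^'a) list" and i assume vs: "length vs = k" "i < k"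
  show "linear (\<lambda>v. F (vs[i := v] @ ws))"
    using F[unfolded alternating_multilinear_def, rule_format, of "vs @ ws", THEN conjunct1,
        rule_format, of i] vs
    by (simp add: list_update_append1)
  fix j assume "j < k" "i \<noteq> j \<and> vs ! i = vs ! j"
  then show "F (vs @ ws) = 0"
    using F[unfolded alternating_multilinear_def, rule_format, of "vs @ ws", THEN conjunct2,
        rule_format, of i j] vs
    by (auto simp: nth_append)
qed

lemma alternating_map:
  fixes B :: "real^'n^'n"
  assumes F: "alternating_multilinear k F"
  shows "alternating_multilinear k (\<lambda>vs. F (map ((*v) B) vs))"
  unfolding alternating_multilinear_def
proof (intro allI impI conjI)
  fix vs :: "(real^'n) list" and i assume vs: "length vs = k" "i < k"
  have lin: "linear (\<lambda>v. F ((map ((*v) B) vs)[i := v]))"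
    using F vs by (simp add: alternating_multilinear_def)
  show "linear (\<lambda>v. F (map ((*v) B) (vs[i := v])))"
    using linear_compose[OF matrix_vector_mul_linear lin] by (simp add: map_update o_def)
  fix j assume "j < k" "i \<noteq> j \<and> vs ! i = vs ! j"
  then show "F (map ((*v) B) vs) = 0"
    using F vs by (auto simp: alternating_multilinear_def)
qed

text \<open>The part of the volume form that does not depend on the metric.\<close>

definition columns_det :: "(real^'n::{finite,wellorder}) list \<Rightarrow> real" where
  "columns_det vs = det (\<chi> i j. (vs ! card {..<j}) $ i)"

lemma inj_position: "inj (\<lambda>j :: 'n::{finite,wellorder}. card {..<j})"
proof (rule injI)
  fix i j :: 'n assume eq: "card {..<i} = card {..<j}"
  have "card {..<a} < card {..<b}" if "a < b" for a b :: 'n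
    using that by (intro psubset_card_mono) auto
  then show "i = j" using eq by (metis less_irrefl linorder_less_linear)
qed

lemma position_less: "card {..<j} < CARD('n)" for j :: "'n::{finite,wellorder}"
  by (intro psubset_card_mono) auto

lemma bij_position: "bij_betw (\<lambda>j :: 'n::{finite,wellorder}. card {..<j}) UNIV {..<CARD('n)}"
proof -
  have "range (\<lambda>j :: 'n. card {..<j}) = {..<CARD('n)}"
    by (rule card_subset_eq) (auto simp: position_less card_image[OF inj_position])
  then show ?thesis using inj_position by (simp add: bij_betw_def)
qed

lemma columns_det_alternating:
  "alternating_multilinear CARD('n) (columns_det :: (real^'n::{finite,wellorder}) list \<Rightarrow> real)"
  unfolding alternating_multilinear_def
proof (intro allI impI conjI)
  fix vs :: "((real, 'n) vec) list" and i assume vs: "length vs = CARD('n)" "i < CARD('n)"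
  have rows: "columns_det ws = det (\<chi> j. ws ! card {..<j})" for ws :: "((real, 'n) vec) list"
    unfolding columns_det_def
    by (subst det_transpose[symmetric]) (simp add: transpose_def vec_lambda_eta cong: if_cong)
  obtain p :: 'n where p: "card {..<p} = i"
    using bij_position vs(2) by (metis bij_betw_iff_bijections lessThan_iff)
  have row: "columns_det (vs[i := v]) = det (\<chi> j. if j = p then v else vs ! card {..<j})" for v
  proof -
    have "i = card {..<j} \<longleftrightarrow> j = p" for j
      using p injD[OF inj_position] by blast
    then have "vs[i := v] ! card {..<j} = (if j = p then v else vs ! card {..<j})" for j
      using vs by (simp add: nth_list_update)
    then show ?thesis by (simp add: rows)
  qed
  show "linear (\<lambda>v. columns_det (vs[i := v]))"
  proof (rule linearI)
    fix v w :: "(real, 'n) vec" and c :: real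
    show "columns_det (vs[i := v + w]) = columns_det (vs[i := v]) + columns_det (vs[i := w])"
      unfolding row by (rule det_row_add)
    show "columns_det (vs[i := c *\<^sub>R v]) = c *\<^sub>R columns_det (vs[i := v])"
      unfolding row using det_row_mul[of p c "\<lambda>_. v", unfolded scalar_mult_eq_scaleR] by simp
  qed
  fix j assume j: "j < CARD('n)" "i \<noteq> j \<and> vs ! i = vs ! j"
  obtain q :: 'n where q: "card {..<q} = j"
    using bij_position j(1) by (metis bij_betw_iff_bijections lessThan_iff)
  show "columns_det vs = 0"
    unfolding rows using j p q
    by (intro det_identical_rows[of p q]) (auto simp: row_def vec_eq_iff)
qed

lemma columns_det_map:
  fixes B :: "((real, 'n) vec, 'n::{finite,wellorder}) vec"
  assumes "length vs = CARD('n)"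
  shows "columns_det (map ((*v) B) vs) = det B * columns_det vs"
proof -
  have "card {..<j} < length vs" for j :: 'n
    using position_less assms by metis
  then have "(\<chi> i j :: 'n. (map ((*v) B) vs ! card {..<j}) $ i)
      = B ** (\<chi> i j :: 'n. (vs ! card {..<j}) $ i)"
    by (simp add: vec_eq_iff matrix_matrix_mult_def matrix_vector_mult_def)
  then show ?thesis by (simp add: columns_det_def det_mul)
qed

text \<open>The matrix is a column permutation of the identity.\<close>

lemma columns_det_frame_nonzero:
  fixes L :: "'n::{finite,wellorder} list"
  assumes "distinct L" "length L = CARD('n)"
  shows "columns_det (frame L) \<noteq> 0"
proof -
  define p where "p j = L ! card {..<j}" for j :: 'n
  have less: "card {..<j} < length L" for j :: 'n
    using position_less[of j] assms(2) by simp
  have "inj p"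
  proof (rule injI)
    fix i j assume "p i = p j"
    then have "card {..<i} = card {..<j}"
      using nth_eq_iff_index_eq[OF assms(1) less less] by (simp add: p_def)
    then show "i = j" by (rule injD[OF inj_position])
  qed
  then have p: "p permutes UNIV"
    by (intro inj_imp_permutes) auto
  have "(\<chi> i j :: 'n. (frame L ! card {..<j}) $ i) = (\<chi> i j. (mat 1 :: ((real, 'n) vec, 'n) vec) $ i $ p j)"
    using less by (auto simp: vec_eq_iff frame_def p_def mat_def axis_def)
  then have "columns_det (frame L) = of_int (sign p)"
    using det_permute_columns[OF p, of "mat 1 :: ((real, 'n) vec, 'n) vec"] by (simp add: columns_det_def)
  then show ?thesis by (simp add: sign_def)
qed

lemma contraction_mat_1:
  "contraction (mat 1) k F H = (\<Sum>I | length I = k. F (frame I) * H (frame I))"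
proof -
  have "(\<Prod>a<k. (mat 1 :: real^'a^'a) $ (I ! a) $ (J ! a)) = (if J = I then 1 else 0)"
    if len: "length I = k" "length J = k" for I J :: "'a list"
  proof (cases "J = I")
    case False
    then obtain a where "a < k" "I ! a \<noteq> J ! a" using len by (metis nth_equalityI)
    then show ?thesis using False by (auto simp: mat_def intro!: prod_zero)
  qed (simp add: mat_def)
  then have "contraction (mat 1) k F H = (\<Sum>I | length I = k. \<Sum>J | length J = k.
      if J = I then F (frame I) * H (frame J) else 0)"
    unfolding contraction_def by (intro sum.cong refl) (auto simp: mult_ac)
  also have "\<dots> = (\<Sum>I | length I = k. F (frame I) * H (frame I))"
    by (intro sum.cong refl) simp
  finally show ?thesis .
qed

lemma alternating_frame_nonzero_distinct:
  assumes "alternating_multilinear k F" "length I = k" "F (frame I) \<noteq> 0"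
  shows "distinct I"
proof (rule ccontr)
  assume "\<not> distinct I"
  then obtain i j where "i < k" "j < k" "i \<noteq> j" "I ! i = I ! j"
    using assms(2) by (auto simp: distinct_conv_nth)
  then have "F (frame I) = 0"
    using assms(1,2) by (auto simp: alternating_multilinear_def frame_def)
  then show False using assms(3) by simp
qed

text \<open>The algebraic reason why the Hodge star of a nonzero \<open>(n-1)\<close>-form is nonzero. Choose \<open>I\<close> with
  \<open>F(e\<^sub>I) \<noteq> 0\<close> and let \<open>m\<close> be the index missing from \<open>I\<close>. In the sum over \<open>J\<close> of
  \<open>F(e\<^sub>J) det(e\<^sub>J, e\<^sub>m)\<close> only the rearrangements \<open>J\<close> of \<open>I\<close> contribute, and they all contribute the
  same number, so nothing cancels.\<close>

lemma contraction_columns_det_nonzero: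
  fixes F :: "(real^'n::{finite,wellorder}) list \<Rightarrow> real"
  assumes F: "alternating_multilinear (CARD('n) - 1) F"
    and "length vs = CARD('n) - 1" "F vs \<noteq> 0"
  shows "\<exists>m. contraction (mat 1) (CARD('n) - 1) F (\<lambda>ws. columns_det (ws @ [axis m 1])) \<noteq> 0"
proof -
  let ?k = "CARD('n) - 1"
  have card: "CARD('n) = Suc ?k" by simp
  obtain I :: "'n list" where I: "length I = ?k" "F (frame I) \<noteq> 0"
    using multilinear_zero_on_frames[OF alternating_imp_multilinear[OF F]] assms(2,3) by blast
  have "distinct I" using alternating_frame_nonzero_distinct[OF F I] .
  then have "card (set I) < CARD('n)" using I(1) card by (simp add: distinct_card)
  then obtain m where m: "m \<notin> set I" by (metis UNIV_eq_I less_irrefl)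
  define H where "H ws = columns_det (ws @ [axis m 1 :: (real, 'n) vec])" for ws
  have H: "alternating_multilinear ?k H"
    using alternating_append[of ?k "[axis m 1 :: (real, 'n) vec]"] columns_det_alternating[where 'n='n]
    unfolding H_def by simp
  have "frame I @ [axis m 1] = frame (I @ [m])" by (simp add: frame_def)
  then have HI: "H (frame I) \<noteq> 0"
    unfolding H_def using columns_det_frame_nonzero[of "I @ [m]"] \<open>distinct I\<close> m I(1) by simp
  define c where "c = F (frame I) * H (frame I)"
  have summand: "F (frame J) * H (frame J) = c \<or> H (frame J) = 0" if J: "length J = ?k" for J
  proof (cases "H (frame J) = 0")
    case False
    then have "distinct J" using alternating_frame_nonzero_distinct[OF H J] by simp
    have "distinct (J @ [m])"
      using False J alternating_frame_nonzero_distinct[OF columns_det_alternating[where 'n='n], of "J @ [m]"]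
      by (simp add: H_def frame_def)
    then have "set J \<subseteq> UNIV - {m}" "set I \<subseteq> UNIV - {m}" using m by auto
    moreover have "card (UNIV - {m}) = ?k" by simp
    ultimately have "set J = UNIV - {m}" "set I = UNIV - {m}"
      using \<open>distinct J\<close> \<open>distinct I\<close> I J by (metis card_subset_eq distinct_card finite)+
    then have "mset J = mset I"
      using \<open>distinct J\<close> \<open>distinct I\<close> set_eq_iff_mset_eq_distinct by metis
    then have "mset (frame J) = mset (frame I)" by (simp add: frame_def)
    then show ?thesis
      unfolding c_def using alternating_prod_permutation[OF F H] I(1) by simp
  qed simp
  have "c \<noteq> 0" using HI I(2) by (simp add: c_def)
  \<comment> \<open>multiplying by \<open>c\<close> makes every summand nonnegative\<close>
  have "0 < (\<Sum>J | length J = ?k. F (frame J) * H (frame J) * c)"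
  proof (rule sum_pos2[of _ I])
    show "0 < F (frame I) * H (frame I) * c"
      using \<open>c \<noteq> 0\<close> by (simp flip: c_def power2_eq_square)
    show "0 \<le> F (frame J) * H (frame J) * c" if "J \<in> {J. length J = ?k}" for J
      using summand[of J] that by auto
  qed (use I in auto)
  also have "\<dots> = contraction (mat 1) ?k F H * c"
    by (simp add: contraction_mat_1 sum_distrib_right)
  finally have "contraction (mat 1) ?k F H \<noteq> 0" by auto
  then show ?thesis unfolding H_def by blast
qed

section \<open>Positive definite matrices\<close>

definition pos_def :: "real^'n^'n \<Rightarrow> bool" where
  "pos_def B \<longleftrightarrow> (\<forall>v. v \<noteq> 0 \<longrightarrow> 0 < v \<bullet> (B *v v))"

lemma pos_def_invertible:
  assumes "pos_def B"
  shows "invertible B"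
proof -
  have "v = 0" if "B *v v = 0" for v
    using assms that by (metis inner_zero_right less_irrefl pos_def_def)
  then show ?thesis
    using invertible_left_inverse matrix_left_invertible_ker by blast
qed

text \<open>The determinant does not vanish on the segment from the identity to \<open>B\<close>, which consists of
  positive definite matrices, so it keeps its sign.\<close>

lemma pos_def_det_pos:
  fixes B :: "real^'n^'n"
  assumes "pos_def B"
  shows "0 < det B"
proof (rule ccontr)
  assume neg: "\<not> 0 < det B"
  define C where "C t = (1 - t) *\<^sub>R mat 1 + t *\<^sub>R B" for t :: real
  have "continuous_on {0..1} (\<lambda>t. det (C t))"
    unfolding det_def C_def by (intro continuous_intros)
  then obtain t where t: "0 \<le> t" "t \<le> 1" "det (C t) = 0"
    using IVT2'[of "\<lambda>t. det (C t)" 1 0 0] neg by (auto simp: C_def)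
  have "pos_def (C t)"
    unfolding pos_def_def
  proof (intro allI impI)
    fix v :: "real^'n" assume v: "v \<noteq> 0"
    have "v \<bullet> (C t *v v) = (1 - t) * (v \<bullet> v) + t * (v \<bullet> (B *v v))"
      by (simp add: C_def matrix_vector_mult_add_rdistrib scaleR_matrix_vector_assoc[symmetric]
          inner_add_right)
    moreover have "0 < v \<bullet> v" "0 < v \<bullet> (B *v v)" using assms v by (auto simp: pos_def_def)
    ultimately show "0 < v \<bullet> (C t *v v)"
      using t by (cases "t = 0") (auto intro!: add_nonneg_pos)
  qed
  then show False using pos_def_invertible t(3) invertible_det_nz by blast
qed

lemma pos_def_matrix_inv:
  fixes B :: "real^'n^'n"
  assumes "pos_def B"
  shows "pos_def (matrix_inv B)"
  unfolding pos_def_def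
proof (intro allI impI)
  fix w :: "real^'n" assume "w \<noteq> 0"
  define v where "v = matrix_inv B *v w"
  have w: "w = B *v v"
    using matrix_inv_inverse[OF pos_def_invertible[OF assms]]
    by (simp add: v_def matrix_vector_mul_assoc)
  then have "v \<noteq> 0" using \<open>w \<noteq> 0\<close> by auto
  then show "0 < w \<bullet> (matrix_inv B *v w)"
    using assms unfolding v_def[symmetric] by (simp add: w pos_def_def inner_commute)
qed

text \<open>For linear \<open>F\<close> the contraction is the quadratic form of \<open>Q\<close> at the coefficient vector of \<open>F\<close>.\<close>

lemma contraction_1_pos:
  assumes "pos_def Q" "linear (\<lambda>v. F [v])" "F [v] \<noteq> 0"
  shows "0 < contraction Q 1 F F"
proof -
  define w where "w = (\<chi> i. F [axis i 1])"
  have "contraction Q 1 F F = w \<bullet> (Q *v w)"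
    unfolding One_nat_def contraction_Suc
    by (simp add: contraction_def frame_def w_def inner_vec_def matrix_vector_mult_def sum_distrib_left mult_ac)
  moreover have "w \<noteq> 0"
  proof
    assume "w = 0"
    then have "F [axis i 1] = 0" for i by (simp add: w_def vec_eq_iff)
    then show False
      using axis_expansion[of v] linear_sum[OF assms(2), of "\<lambda>i. v $ i *\<^sub>R axis i 1" UNIV]
        linear_cmul[OF assms(2)] assms(3) by simp
  qed
  ultimately show ?thesis using assms(1) by (simp add: pos_def_def)
qed

section \<open>Norm and Hodge star in a chart\<close>

lemma form_norm_contraction:
  "form_norm g k \<omega> c x
    = sqrt (1 / fact k * contraction (matrix_inv (gram g c x)) k (\<omega> c x) (\<omega> c x))"
  unfolding form_norm_def contraction_def inverse_gram_prod_def
  by (intro arg_cong[where f = sqrt] arg_cong2[where f = "(*)"] refl sum.cong) simp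

lemma volume_form_columns_det:
  "volume_form g c x vs = sqrt (det (gram g c x)) * columns_det vs"
  by (simp add: volume_form_def columns_det_def)

lemma hodge_star_contraction:
  "hodge_star g k \<omega> c x vs
    = 1 / fact k * contraction (matrix_inv (gram g c x)) k (\<omega> c x) (\<lambda>ws. volume_form g c x (ws @ vs))"
  unfolding hodge_star_def contraction_def inverse_gram_prod_def
  by (intro arg_cong2[where f = "(*)"] refl sum.cong) simp

lemma form_norm_cmult:
  assumes "\<And>vs. length vs = k \<Longrightarrow> \<xi> c x vs = a * \<omega> c x vs"
  shows "form_norm g k \<xi> c x = \<bar>a\<bar> * form_norm g k \<omega> c x"
proof -
  let ?Q = "matrix_inv (gram g c x)"
  have "contraction ?Q k (\<xi> c x) (\<xi> c x)
      = contraction (1 *\<^sub>R ?Q) k (\<lambda>vs. a * \<omega> c x vs) (\<lambda>vs. a * \<omega> c x vs)"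
    using assms by (auto intro: contraction_cong)
  also have "\<dots> = a\<^sup>2 * contraction ?Q k (\<omega> c x) (\<omega> c x)"
    unfolding contraction_scale by (simp add: power2_eq_square)
  finally show ?thesis
    by (simp add: form_norm_contraction real_sqrt_mult real_sqrt_divide)
qed

lemma bilinear_gram:
  assumes "bilinear (g c x)"
  shows "g c x v w = v \<bullet> (gram g c x *v w)"
proof -
  have l: "linear (\<lambda>v. g c x v w)" and r: "linear (g c x v)" for v w
    using assms by (auto simp: bilinear_def)
  have "g c x v w = g c x (\<Sum>i\<in>UNIV. v $ i *\<^sub>R axis i 1) (\<Sum>j\<in>UNIV. w $ j *\<^sub>R axis j 1)"
    using axis_expansion by metis
  also have "\<dots> = (\<Sum>i\<in>UNIV. \<Sum>j\<in>UNIV. v $ i * (w $ j * g c x (axis i 1) (axis j 1)))"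
    by (simp add: linear_sum[OF l] linear_cmul[OF l] linear_sum[OF r] linear_cmul[OF r]
        sum_distrib_left) (subst sum.swap, simp add: mult_ac)
  also have "\<dots> = v \<bullet> (gram g c x *v w)"
    by (simp add: inner_vec_def matrix_vector_mult_def gram_def sum_distrib_left mult_ac)
  finally show ?thesis .
qed

lemma riemannian_metric_transition:
  assumes "riemannian_metric A g" "c \<in> A" "c' \<in> A" "x \<in> overlap c c'"
  shows "g c x v w
    = g c' (transition c c' x) (transition_deriv c c' x v) (transition_deriv c c' x w)"
  by (rule assms(1)[unfolded riemannian_metric_def, THEN conjunct2, THEN conjunct2, rule_format,
        OF assms(2-4)])

lemma gram_pos_def:
  assumes "riemannian_metric A g" "c \<in> A" "x \<in> chart_image c"
  shows "pos_def (gram g c x)"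
  using assms bilinear_gram[of g c x] unfolding riemannian_metric_def pos_def_def by metis

lemmas gram_det_pos = pos_def_det_pos[OF gram_pos_def]
lemmas gram_invertible = pos_def_invertible[OF gram_pos_def]

lemma smooth_on_gram:
  assumes "riemannian_metric A g" "c \<in> A"
  shows "smooth_on (chart_image c) (\<lambda>x. gram g c x $ i $ j)"
  using assms by (simp add: gram_def riemannian_metric_def)

lemma smooth_on_contraction_gram:
  assumes "riemannian_metric A g" "c \<in> A"
    and "\<And>I. length I = k \<Longrightarrow> smooth_on (chart_image c) (\<lambda>x. F x (frame I))"
    and "\<And>I. length I = k \<Longrightarrow> smooth_on (chart_image c) (\<lambda>x. H x (frame I))"
  shows "smooth_on (chart_image c) (\<lambda>x. contraction (matrix_inv (gram g c x)) k (F x) (H x))"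
  unfolding contraction_def
  by (intro smooth_on_sum smooth_on_mult smooth_on_prod smooth_on_matrix_inv
      smooth_on_gram[OF assms(1,2)] gram_det_pos[OF assms(1,2)] assms(3,4)) auto

lemma alternating_prepend:
  assumes F: "alternating_multilinear (length us + m) F"
  shows "alternating_multilinear m (\<lambda>vs. F (us @ vs))"
  unfolding alternating_multilinear_def
proof (intro allI impI conjI)
  fix vs :: "(real^'a) list" and i assume vs: "length vs = m" "i < m"
  show "linear (\<lambda>v. F (us @ vs[i := v]))"
    using F[unfolded alternating_multilinear_def, rule_format, of "us @ vs", THEN conjunct1,
        rule_format, of "length us + i"] vs
    by (simp add: list_update_append)
  fix j assume "j < m" "i \<noteq> j \<and> vs ! i = vs ! j"
  then show "F (us @ vs) = 0"
    using F[unfolded alternating_multilinear_def, rule_format, of "us @ vs", THEN conjunct2,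
        rule_format, of "length us + i" "length us + j"] vs
    by auto
qed

lemma alternating_cmult:
  "alternating_multilinear k F \<Longrightarrow> alternating_multilinear k (\<lambda>vs. a * F vs)"
  unfolding alternating_multilinear_def
  by (auto simp: linear_iff algebra_simps)

lemma alternating_sum:
  "(\<And>i. i \<in> S \<Longrightarrow> alternating_multilinear k (F i)) \<Longrightarrow> alternating_multilinear k (\<lambda>vs. \<Sum>i\<in>S. F i vs)"
  unfolding alternating_multilinear_def by (auto intro!: linear_compose_sum sum.neutral)

lemma volume_form_alternating:
  "alternating_multilinear CARD('n) (volume_form g c x)"
  for g :: "('a, 'n::{finite,wellorder}) metric"
  using alternating_cmult[OF columns_det_alternating[where 'n='n]]
  by (simp add: volume_form_columns_det[abs_def])

lemma hodge_star_alternating: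
  fixes g :: "('a, 'n::{finite,wellorder}) metric"
  assumes "k + m = CARD('n)"
  shows "alternating_multilinear m (hodge_star g k \<omega> c x)"
  unfolding hodge_star_def[abs_def]
proof (intro alternating_cmult alternating_sum alternating_prepend)
  fix J :: "'n list" assume "J \<in> {J. length J = k}"
  then show "alternating_multilinear (length (frame J) + m) (volume_form g c x)"
    using volume_form_alternating[of g c x] assms by simp
qed

lemma smooth_on_hodge_star:
  fixes g :: "('a, 'n::{finite,wellorder}) metric"
  assumes g: "riemannian_metric A g" "c \<in> A" and "\<omega> \<in> k_forms A k"
  shows "smooth_on (chart_image c) (\<lambda>x. hodge_star g k \<omega> c x vs)"
  unfolding hodge_star_contraction volume_form_columns_det
  using assms(2,3)
  by (intro smooth_on_mult smooth_on_const smooth_on_contraction_gram[OF g] smooth_on_sqrt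
      smooth_on_det smooth_on_gram[OF g] gram_det_pos[OF g]) (auto simp: k_forms_def)

lemma form_norm_1_pos:
  assumes "riemannian_metric A g" "c \<in> A" "x \<in> chart_image c"
    and "alternating_multilinear 1 (\<omega> c x)" "\<omega> c x [v] \<noteq> 0"
  shows "0 < form_norm g 1 \<omega> c x"
proof -
  have "linear (\<lambda>v. \<omega> c x [v])"
    using assms(4)[unfolded alternating_multilinear_def, rule_format, of "[0]"] by simp
  then have "0 < contraction (matrix_inv (gram g c x)) 1 (\<omega> c x) (\<omega> c x)"
    using contraction_1_pos[OF pos_def_matrix_inv[OF gram_pos_def[OF assms(1-3)]], of "\<omega> c x"]
      assms(5) by blast
  then show ?thesis unfolding form_norm_contraction by simp
qed

text \<open>Raising all indices of \<open>\<beta>\<close> by the inverse Gram matrix gives an alternating function \<open>F\<close> that is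
  again nonzero. Up to a constant the star is the contraction of \<open>F\<close> with the volume form with respect
  to the identity matrix.\<close>

lemma hodge_star_hyperform_nonzero:
  fixes g :: "('a, 'n::{finite,wellorder}) metric"
  assumes "riemannian_metric A g" "c \<in> A" "x \<in> chart_image c"
    and \<beta>: "alternating_multilinear (CARD('n) - 1) (\<beta> c x)"
    and "length vs = CARD('n) - 1" "\<beta> c x vs \<noteq> 0"
  shows "\<exists>m. hodge_star g (CARD('n) - 1) \<beta> c x [axis m 1] \<noteq> 0"
proof -
  let ?k = "CARD('n) - 1" and ?G = "gram g c x"
  define F where "F ws = \<beta> c x (map ((*v) (matrix_inv ?G)) ws)" for ws
  have F: "alternating_multilinear ?k F"
    unfolding F_def by (rule alternating_map[OF \<beta>])
  have "map ((*v) (matrix_inv ?G)) (map ((*v) ?G) vs) = vs"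
    using matrix_inv_inverse(2)[OF gram_invertible[OF assms(1-3)]]
    by (simp add: o_def matrix_vector_mul_assoc)
  then have "F (map ((*v) ?G) vs) \<noteq> 0" using assms(6) by (simp add: F_def)
  then obtain m where m: "contraction (mat 1) ?k F (\<lambda>ws. columns_det (ws @ [axis m 1])) \<noteq> 0"
    using contraction_columns_det_nonzero[OF F, of "map ((*v) ?G) vs"] assms(5) by auto
  define H where "H ws = volume_form g c x (ws @ [axis m 1])" for ws
  have H: "alternating_multilinear ?k H"
    using alternating_append[of ?k "[axis m 1 :: (real, 'n) vec]" "volume_form g c x"]
      volume_form_alternating[of g c x] by (simp add: H_def[abs_def])
  have mat1: "(*v) (mat 1 :: ((real, 'n) vec, 'n) vec) = id" by (simp add: fun_eq_iff)
  have "contraction (matrix_inv ?G) ?k (\<beta> c x) H = contraction (mat 1) ?k F H"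
    using contraction_map[OF alternating_imp_multilinear[OF \<beta>] alternating_imp_multilinear[OF H],
        of "mat 1" "matrix_inv ?G" "mat 1"]
    by (simp add: F_def[abs_def] mat1 transpose_mat)
  also have "\<dots> = sqrt (det ?G) * contraction (mat 1) ?k F (\<lambda>ws. columns_det (ws @ [axis m 1]))"
    using contraction_scale[of 1 "mat 1" ?k 1 F "sqrt (det ?G)"
        "\<lambda>ws. columns_det (ws @ [axis m 1])"]
    by (simp add: H_def[abs_def] volume_form_columns_det)
  finally have "contraction (matrix_inv ?G) ?k (\<beta> c x) H \<noteq> 0"
    using m gram_det_pos[OF assms(1-3)] by simp
  then show ?thesis
    unfolding hodge_star_contraction by (intro exI[of _ m]) (simp add: H_def[abs_def])
qed

section \<open>Conformal rescaling\<close>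

text \<open>The conformal factor is written as a square of a positive function \<open>\<phi>\<close> given in each chart; this is
  the form in which the norm of a form provides it. In the exponential form \<open>\<phi> = e\<^sup>u\<close>.\<close>

definition rescaled_metric ::
    "(('a,'n::finite) chart \<Rightarrow> (real, 'n) vec \<Rightarrow> real) \<Rightarrow> ('a,'n) metric \<Rightarrow> ('a,'n) metric" where
  "rescaled_metric \<phi> g c x v w = (\<phi> c x)\<^sup>2 * g c x v w"

lemma gram_rescaled: "gram (rescaled_metric \<phi> g) c x = (\<phi> c x)\<^sup>2 *\<^sub>R gram g c x"
  by (simp add: gram_def rescaled_metric_def vec_eq_iff)

lemma matrix_inv_scaleR:
  fixes B :: "real^'n^'n"
  assumes "invertible B" "a \<noteq> 0"
  shows "matrix_inv (a *\<^sub>R B) = inverse a *\<^sub>R matrix_inv B"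
  by (rule matrix_inv_eqI)
    (use assms matrix_inv_inverse(2)[OF assms(1)] in \<open>simp add: scalar_matrix_assoc[symmetric] matrix_scalar_ac\<close>)

lemma det_scaleR: "det (a *\<^sub>R B) = a ^ CARD('n) * det B" for B :: "real^'n^'n"
  using det_rows_mul[of "\<lambda>_. a" "\<lambda>i. B $ i"]
  by (simp add: scalar_mult_eq_scaleR vec_lambda_eta scaleR_vec_def)

text \<open>The Gram matrix, its inverse and the root of its determinant acquire the factors \<open>\<phi>\<^sup>2\<close>, \<open>\<phi>\<^sup>-\<^sup>2\<close> and
  \<open>\<phi>\<^sup>n\<close>. All scaling laws below follow from this by counting the factors in the contraction.\<close>

lemma volume_form_rescaled:
  fixes g :: "('a, 'n::{finite,wellorder}) metric"
  assumes "0 < \<phi> c x"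
  shows "volume_form (rescaled_metric \<phi> g) c x vs = \<phi> c x ^ CARD('n) * volume_form g c x vs"
proof -
  have "((\<phi> c x)\<^sup>2) ^ CARD('n) = (\<phi> c x ^ CARD('n))\<^sup>2" by (simp add: power_mult[symmetric] mult.commute)
  then show ?thesis
    using assms by (simp add: volume_form_columns_det gram_rescaled det_scaleR real_sqrt_mult)
qed

lemma form_norm_rescaled:
  assumes "0 < \<phi> c x" "invertible (gram g c x)"
  shows "form_norm (rescaled_metric \<phi> g) k \<omega> c x = form_norm g k \<omega> c x / \<phi> c x ^ k"
proof -
  let ?Q = "matrix_inv (gram g c x)"
  have "contraction (matrix_inv (gram (rescaled_metric \<phi> g) c x)) k (\<omega> c x) (\<omega> c x)
      = inverse ((\<phi> c x)\<^sup>2) ^ k * contraction ?Q k (\<omega> c x) (\<omega> c x)"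
    using assms contraction_scale[of "inverse ((\<phi> c x)\<^sup>2)" ?Q k 1 "\<omega> c x" 1 "\<omega> c x"]
    by (simp add: gram_rescaled matrix_inv_scaleR)
  moreover have "inverse ((\<phi> c x)\<^sup>2) ^ k = (inverse (\<phi> c x ^ k))\<^sup>2"
    by (simp add: power_inverse power_mult[symmetric] mult.commute)
  ultimately show ?thesis
    using assms(1) by (simp add: form_norm_contraction real_sqrt_mult real_sqrt_divide divide_inverse)
qed

lemma hodge_star_rescaled:
  fixes g :: "('a, 'n::{finite,wellorder}) metric"
  assumes "0 < \<phi> c x" "invertible (gram g c x)"
  shows "hodge_star (rescaled_metric \<phi> g) k \<omega> c x vs
    = \<phi> c x ^ CARD('n) / \<phi> c x ^ (2 * k) * hodge_star g k \<omega> c x vs"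
proof -
  let ?Q = "matrix_inv (gram g c x)"
  have "contraction (matrix_inv (gram (rescaled_metric \<phi> g) c x)) k (\<omega> c x)
        (\<lambda>ws. volume_form (rescaled_metric \<phi> g) c x (ws @ vs))
      = inverse ((\<phi> c x)\<^sup>2) ^ k * \<phi> c x ^ CARD('n)
        * contraction ?Q k (\<omega> c x) (\<lambda>ws. volume_form g c x (ws @ vs))"
    using assms contraction_scale[of "inverse ((\<phi> c x)\<^sup>2)" ?Q k 1 "\<omega> c x" "\<phi> c x ^ CARD('n)"
        "\<lambda>ws. volume_form g c x (ws @ vs)"]
    by (simp add: gram_rescaled matrix_inv_scaleR volume_form_rescaled[of \<phi>])
  then show ?thesis
    by (simp add: hodge_star_contraction power_inverse power_mult[symmetric] divide_inverse)
qed

text \<open>The exponent \<open>n - 2 (n - 1)\<close> is at most 0; the statement divides by the opposite power to stay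
  within the natural numbers.\<close>

lemma hodge_star_hyperform_rescaled:
  fixes g :: "('a, 'n::{finite,wellorder}) metric"
  assumes "0 < \<phi> c x" "invertible (gram g c x)" "2 \<le> CARD('n)"
  shows "hodge_star (rescaled_metric \<phi> g) (CARD('n) - 1) \<omega> c x vs
    = hodge_star g (CARD('n) - 1) \<omega> c x vs / \<phi> c x ^ (CARD('n) - 2)"
proof -
  have "2 * (CARD('n) - 1) = CARD('n) + (CARD('n) - 2)" using assms(3) by simp
  then show ?thesis
    using assms(1) by (simp add: hodge_star_rescaled[of \<phi>, OF assms(1,2)] power_add)
qed

section \<open>Closedness depends only on the values in the charts\<close>

lemma frechet_derivative_within_cong:
  assumes "x \<in> S" "\<And>y. y \<in> S \<Longrightarrow> f y = g y"
  shows "frechet_derivative f (at x within S) = frechet_derivative g (at x within S)"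
proof -
  have "(f has_derivative D) (at x within S) \<longleftrightarrow> (g has_derivative D) (at x within S)" for D
    using has_derivative_transform[OF assms(1)] assms(2) by metis
  then show ?thesis by (simp add: frechet_derivative_def)
qed

lemma closed_form_cong:
  assumes "\<And>c x vs. c \<in> A \<Longrightarrow> x \<in> chart_image c \<Longrightarrow> length vs = k \<Longrightarrow> \<omega> c x vs = \<eta> c x vs"
    and "closed_form A k \<omega>"
  shows "closed_form A k \<eta>"
  unfolding closed_form_def
proof (intro ballI allI impI)
  fix c x vs assume *: "c \<in> A" "x \<in> chart_image c" "length (vs :: (real, 'b) vec list) = Suc k"
  have "exterior_derivative \<eta> c x vs = exterior_derivative \<omega> c x vs"
    unfolding exterior_derivative_def
  proof (rule sum.cong[OF refl])
    fix i assume "i \<in> {..<length vs}"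
    then have "length (take i vs @ drop (Suc i) vs) = k" using * by simp
    then have "frechet_derivative (\<lambda>y. \<eta> c y (take i vs @ drop (Suc i) vs)) (at x within chart_image c)
        = frechet_derivative (\<lambda>y. \<omega> c y (take i vs @ drop (Suc i) vs)) (at x within chart_image c)"
      using assms(1) * by (intro frechet_derivative_within_cong) auto
    then show "(-1) ^ i * frechet_derivative (\<lambda>y. \<eta> c y (take i vs @ drop (Suc i) vs))
          (at x within chart_image c) (vs ! i)
        = (-1) ^ i * frechet_derivative (\<lambda>y. \<omega> c y (take i vs @ drop (Suc i) vs))
          (at x within chart_image c) (vs ! i)"
      by simp
  qed
  also have "\<dots> = 0" using assms(2) * unfolding closed_form_def by blast
  finally show "exterior_derivative \<eta> c x vs = 0" .
qed

section \<open>Independence of the chart\<close>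

locale oriented_manifold =
  fixes M :: "'a topology" and A :: "('a,'n::{finite,wellorder}) chart set"
  assumes manifold: "smooth_manifold_with_boundary M A" and oriented: "oriented_atlas A"
begin

lemma inj_on_chart: "c \<in> A \<Longrightarrow> inj_on (snd c) (fst c)"
proof -
  assume "c \<in> A"
  then have "is_chart M c" using manifold by (simp add: smooth_manifold_with_boundary_def)
  then have "openin M (fst c)" "inj_on (snd c) (topspace (subtopology M (fst c)))"
    unfolding is_chart_def using homeomorphic_imp_injective_map by blast+
  then show ?thesis by (metis openin_subset topspace_subtopology_subset)
qed

lemma chart_inverse: "c \<in> A \<Longrightarrow> p \<in> fst c \<Longrightarrow> inv_into (fst c) (snd c) (snd c p) = p"
  by (rule inv_into_f_f[OF inj_on_chart])

lemma transition_chart: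
  "c \<in> A \<Longrightarrow> p \<in> fst c \<Longrightarrow> transition c c' (snd c p) = snd c' p"
  by (simp add: transition_def chart_inverse)

lemma overlapE:
  assumes "c \<in> A" "x \<in> overlap c c'"
  obtains "x \<in> chart_image c" "transition c c' x \<in> chart_image c'"
  using assms by (auto simp: overlap_def chart_image_def transition_chart)

text \<open>A smooth extension of the transition map to an open set has a derivative, which restricts to a
  derivative within the overlap. Hence the derivative chosen there is a linear map.\<close>

lemma transition_deriv_linear:
  assumes "c \<in> A" "c' \<in> A" "x \<in> overlap c c'"
  shows "linear (transition_deriv c c' x)"
proof -
  have "smooth_on (overlap c c') (transition c c')"
    using manifold assms(1,2) by (simp add: smooth_manifold_with_boundary_def)
  then obtain W F where W: "open W" "x \<in> W" "\<forall>k. Ck_on k W F"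
      "\<forall>y\<in>overlap c c' \<inter> W. F y = transition c c' y"
    using assms(3) unfolding smooth_on_def by metis
  define D where "D = frechet_derivative F (at x)"
  have "(F has_derivative D) (at x)"
    unfolding D_def using W(3)[rule_format, of "Suc 0"] W(2) by (rule Ck_on_SucD)
  then have D: "(F has_derivative D) (at x within overlap c c')"
    by (rule has_derivative_at_withinI)
  obtain d where d: "0 < d" "ball x d \<subseteq> W" using W(1,2) openE by blast
  have "(transition c c' has_derivative D) (at x within overlap c c')"
    by (rule has_derivative_transform_within[OF D d(1) assms(3)])
      (use W(4) d(2) in \<open>auto simp: dist_commute subset_iff\<close>)
  then have "transition c c' differentiable (at x within overlap c c')"
    by (auto simp: differentiable_def)
  then have "(transition c c' has_derivative transition_deriv c c' x) (at x within overlap c c')"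
    unfolding transition_deriv_def by (simp add: frechet_derivative_works)
  then show ?thesis by (rule has_derivative_linear)
qed

lemma transition_deriv_matrix:
  assumes "c \<in> A" "c' \<in> A" "x \<in> overlap c c'"
  shows "transition_deriv c c' x = (*v) (matrix (transition_deriv c c' x))"
  using matrix_vector_mul(2)[OF transition_deriv_linear[OF assms]] by (rule sym)

lemma gram_transition:
  assumes "riemannian_metric A g" "c \<in> A" "c' \<in> A" "x \<in> overlap c c'"
  defines "P \<equiv> matrix (transition_deriv c c' x)"
  shows "gram g c x = transpose P ** gram g c' (transition c c' x) ** P"
proof -
  let ?G = "gram g c' (transition c c' x)"
  have bil: "bilinear (g c' (transition c c' x))"
    using assms(1-4) overlapE[OF assms(2,4)] by (metis riemannian_metric_def)
  have D: "transition_deriv c c' x = (*v) P"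
    unfolding P_def by (rule transition_deriv_matrix[OF assms(2-4)])
  have "g c x v w = g c' (transition c c' x) (P *v v) (P *v w)" for v w
    using riemannian_metric_transition[OF assms(1-4)] unfolding D .
  then have "gram g c x $ i $ j = (P *v axis i 1) \<bullet> (?G *v (P *v axis j 1))" for i j
    by (simp add: gram_def[of g c] bilinear_gram[of g c', OF bil])
  moreover have "(P *v v) \<bullet> w = v \<bullet> (transpose P *v w)" for v w
    by (metis dot_lmul_matrix inner_commute transpose_matrix_vector)
  ultimately have "gram g c x $ i $ j = axis i 1 \<bullet> ((transpose P ** ?G ** P) *v axis j 1)" for i j
    by (simp add: matrix_vector_mul_assoc matrix_mul_assoc del: transpose_matrix_vector)
  then show ?thesis
    by (simp add: vec_eq_iff inner_axis' matrix_vector_mult_basis column_def)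
qed

lemma matrix_inv_gram_transition:
  assumes "riemannian_metric A g" "c \<in> A" "c' \<in> A" "x \<in> overlap c c'"
  defines "P \<equiv> matrix (transition_deriv c c' x)"
  shows "matrix_inv (gram g c' (transition c c' x)) = P ** matrix_inv (gram g c x) ** transpose P"
proof (rule matrix_inv_eqI)
  let ?G = "gram g c x" and ?G' = "gram g c' (transition c c' x)"
  have "0 < det P" using oriented assms(2-4) by (simp add: oriented_atlas_def P_def)
  then have P: "invertible P" by (simp add: invertible_det_nz)
  have G: "matrix_inv ?G ** ?G = mat 1"
    using gram_invertible[OF assms(1,2)] overlapE[OF assms(2,4)] matrix_inv_inverse(2) by metis
  have "P ** matrix_inv ?G ** transpose P ** ?G' = P ** (matrix_inv ?G ** (transpose P ** ?G' ** P)) ** matrix_inv P"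
    using matrix_inv_inverse(1)[OF P] by (simp add: matrix_mul_assoc[symmetric])
  also have "\<dots> = mat 1"
    unfolding P_def gram_transition[OF assms(1-4), symmetric] G
    using matrix_inv_inverse(1)[OF P] by (simp add: P_def)
  finally show "P ** matrix_inv ?G ** transpose P ** ?G' = mat 1" .
qed

lemma form_transition:
  assumes "\<omega> \<in> k_forms A k" "c \<in> A" "c' \<in> A" "x \<in> overlap c c'" "length vs = k"
  shows "\<omega> c x vs
    = \<omega> c' (transition c c' x) (map ((*v) (matrix (transition_deriv c c' x))) vs)"
  using assms by (simp add: k_forms_def transition_deriv_matrix[OF assms(2-4), symmetric])

lemma form_multilinear:
  assumes "\<omega> \<in> k_forms A k" "c \<in> A" "c' \<in> A" "x \<in> overlap c c'"
  shows "multilinear k (\<omega> c' (transition c c' x))"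
proof -
  have "transition c c' x \<in> chart_image c'" using overlapE[OF assms(2,4)] .
  then show ?thesis
    using assms(1,3) by (intro alternating_imp_multilinear) (simp add: k_forms_def)
qed

lemma contraction_transition:
  assumes g: "riemannian_metric A g" and c: "c \<in> A" "c' \<in> A" "x \<in> overlap c c'"
    and "multilinear k F'" "multilinear k H'"
    and "\<And>vs. length vs = k \<Longrightarrow> F vs = F' (map ((*v) (matrix (transition_deriv c c' x))) vs)"
    and "\<And>vs. length vs = k \<Longrightarrow> H vs = H' (map ((*v) (matrix (transition_deriv c c' x))) vs)"
  shows "contraction (matrix_inv (gram g c x)) k F H
    = contraction (matrix_inv (gram g c' (transition c c' x))) k F' H'"
  unfolding matrix_inv_gram_transition[OF g c] contraction_map[OF assms(5,6), symmetric]
  by (rule contraction_cong) (simp_all add: assms(7,8))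

lemma form_norm_transition:
  assumes "riemannian_metric A g" "\<omega> \<in> k_forms A k" "c \<in> A" "c' \<in> A" "x \<in> overlap c c'"
  shows "form_norm g k \<omega> c' (transition c c' x) = form_norm g k \<omega> c x"
proof -
  have "contraction (matrix_inv (gram g c x)) k (\<omega> c x) (\<omega> c x)
      = contraction (matrix_inv (gram g c' (transition c c' x))) k
          (\<omega> c' (transition c c' x)) (\<omega> c' (transition c c' x))"
    by (intro contraction_transition[OF assms(1,3-5)] form_multilinear[OF assms(2-5)]
        form_transition[OF assms(2-5)])
  then show ?thesis by (simp add: form_norm_contraction)
qed

text \<open>The root of the Gram determinant changes by \<open>\<bar>det P\<bar>\<close> and the determinant of the arguments by
  \<open>det P\<close>; the two factors agree because the orientation makes \<open>det P\<close> positive.\<close>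

lemma volume_form_transition:
  assumes "riemannian_metric A g" "c \<in> A" "c' \<in> A" "x \<in> overlap c c'" "length vs = CARD('n)"
  defines "P \<equiv> matrix (transition_deriv c c' x)"
  shows "volume_form g c x vs = volume_form g c' (transition c c' x) (map ((*v) P) vs)"
proof -
  have "0 < det P" using oriented assms(2-4) by (simp add: oriented_atlas_def P_def)
  moreover have "det (gram g c x) = (det P)\<^sup>2 * det (gram g c' (transition c c' x))"
    unfolding gram_transition[OF assms(1-4)]
    by (simp add: det_mul det_transpose P_def power2_eq_square)
  ultimately show ?thesis
    using assms(5) by (simp add: volume_form_columns_det columns_det_map real_sqrt_mult)
qed

lemma hodge_star_form:
  assumes g: "riemannian_metric A g" and \<omega>: "\<omega> \<in> k_forms A k" and "k + m = CARD('n)"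
  shows "hodge_star g k \<omega> \<in> k_forms A m"
proof -
  have "hodge_star g k \<omega> c x vs
      = hodge_star g k \<omega> c' (transition c c' x) (map (transition_deriv c c' x) vs)"
    if c: "c \<in> A" "c' \<in> A" "x \<in> overlap c c'" and vs: "length vs = m" for c c' x vs
  proof -
    let ?P = "matrix (transition_deriv c c' x)"
    let ?H' = "\<lambda>ws. volume_form g c' (transition c c' x) (ws @ map ((*v) ?P) vs)"
    have "multilinear k ?H'"
      using alternating_append[of k "map ((*v) ?P) vs" "volume_form g c' (transition c c' x)"]
        volume_form_alternating[of g c' "transition c c' x"] vs assms(3)
      by (auto intro: alternating_imp_multilinear)
    moreover have "volume_form g c x (ws @ vs) = ?H' (map ((*v) ?P) ws)" if "length ws = k" for ws
      using volume_form_transition[OF g c, of "ws @ vs"] that vs assms(3) by simp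
    ultimately have "contraction (matrix_inv (gram g c x)) k (\<omega> c x) (\<lambda>ws. volume_form g c x (ws @ vs))
        = contraction (matrix_inv (gram g c' (transition c c' x))) k (\<omega> c' (transition c c' x)) ?H'"
      by (intro contraction_transition[OF g c] form_multilinear[OF \<omega> c] form_transition[OF \<omega> c])
    then show ?thesis
      by (simp add: hodge_star_contraction transition_deriv_matrix[OF c, symmetric])
  qed
  then show ?thesis
    using smooth_on_hodge_star[OF g _ \<omega>]
    by (simp add: k_forms_def hodge_star_alternating[OF assms(3)])
qed

text \<open>The exponent of the conformal factor must be a function on the manifold, whereas \<open>\<phi>\<close> is given chart
  by chart. At each point \<open>ln \<phi>\<close> is read in an arbitrarily chosen chart; compatibility under the
  transition maps makes the choice immaterial and yields smoothness in every chart.\<close>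

lemma rescaled_metric_conformal:
  assumes h: "h \<in> conformal_class A g"
    and pos: "\<And>c x. c \<in> A \<Longrightarrow> x \<in> chart_image c \<Longrightarrow> 0 < \<phi> c x"
    and smooth: "\<And>c. c \<in> A \<Longrightarrow> smooth_on (chart_image c) (\<phi> c)"
    and compat: "\<And>c c' x. c \<in> A \<Longrightarrow> c' \<in> A \<Longrightarrow> x \<in> overlap c c' \<Longrightarrow> \<phi> c' (transition c c' x) = \<phi> c x"
  shows "rescaled_metric \<phi> h \<in> conformal_class A g"
proof -
  obtain u where u: "smooth_function A u" and
    hu: "\<forall>c\<in>A. \<forall>p\<in>fst c. \<forall>v w. h c (snd c p) v w = exp (2 * u p) * g c (snd c p) v w"
    and metric: "riemannian_metric A h"
    using h unfolding conformal_class_def by blast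
  \<comment> \<open>an arbitrary chart around each point\<close>
  define c0 where "c0 p = (SOME c. c \<in> A \<and> p \<in> fst c)" for p
  define w where "w p = ln (\<phi> (c0 p) (snd (c0 p) p))" for p
  have w: "w p = ln (\<phi> c (snd c p))" if "c \<in> A" "p \<in> fst c" for c p
  proof -
    have c0: "c0 p \<in> A" "p \<in> fst (c0 p)"
      using someI[of "\<lambda>c. c \<in> A \<and> p \<in> fst c"] that by (auto simp: c0_def)
    then have "snd c p \<in> overlap c (c0 p)" using that by (auto simp: overlap_def)
    then show ?thesis
      using compat[OF that(1) c0(1)] transition_chart[OF that] by (metis w_def)
  qed
  have "smooth_function A (\<lambda>p. u p + w p)"
    unfolding smooth_function_def
  proof
    fix c assume c: "c \<in> A"
    have "smooth_on (chart_image c) (u \<circ> inv_into (fst c) (snd c))"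
      using u c by (simp add: smooth_function_def)
    then have "smooth_on (chart_image c) (\<lambda>x. (u \<circ> inv_into (fst c) (snd c)) x + ln (\<phi> c x))"
      by (rule smooth_on_add[OF _ smooth_on_ln[OF smooth[OF c] pos[OF c]]])
    then show "smooth_on (chart_image c) ((\<lambda>p. u p + w p) \<circ> inv_into (fst c) (snd c))"
      by (rule smooth_on_cong[THEN iffD1, rotated])
        (auto simp: chart_image_def chart_inverse[OF c] w[OF c])
  qed
  moreover have "rescaled_metric \<phi> h c (snd c p) v v' = exp (2 * (u p + w p)) * g c (snd c p) v v'"
    if "c \<in> A" "p \<in> fst c" for c p v v'
  proof -
    have "0 < \<phi> c (snd c p)" using pos that by (simp add: chart_image_def)
    then have "exp (2 * w p) = (\<phi> c (snd c p))\<^sup>2"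
      using w[OF that] by (simp add: exp_double)
    then show ?thesis using hu that by (simp add: rescaled_metric_def exp_add algebra_simps)
  qed
  moreover have "riemannian_metric A (rescaled_metric \<phi> h)"
    unfolding riemannian_metric_def
  proof (intro conjI ballI allI impI)
    fix c x assume cx: "c \<in> A" "x \<in> chart_image c"
    have b: "bilinear (h c x)" using metric cx by (simp add: riemannian_metric_def)
    show "bilinear (rescaled_metric \<phi> h c x)"
      using b by (simp add: bilinear_def rescaled_metric_def linear_iff algebra_simps)
    show "rescaled_metric \<phi> h c x v v' = rescaled_metric \<phi> h c x v' v" for v v'
      using metric cx by (simp add: riemannian_metric_def rescaled_metric_def)
    show "0 < rescaled_metric \<phi> h c x v v" if "v \<noteq> 0" for v
      using metric pos[OF cx] cx that by (simp add: riemannian_metric_def rescaled_metric_def)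
  next
    fix c v v' assume c: "c \<in> A"
    have "smooth_on (chart_image c) (\<lambda>x. h c x v v')"
      using metric c by (simp add: riemannian_metric_def)
    then show "smooth_on (chart_image c) (\<lambda>x. rescaled_metric \<phi> h c x v v')"
      unfolding rescaled_metric_def power2_eq_square
      by (intro smooth_on_mult smooth[OF c])
  next
    fix c c' x v v' assume c: "c \<in> A" "c' \<in> A" "x \<in> overlap c c'"
    have "h c x v v' = h c' (transition c c' x) (transition_deriv c c' x v)
        (transition_deriv c c' x v')"
      by (rule riemannian_metric_transition[OF metric c])
    then show "rescaled_metric \<phi> h c x v v' = rescaled_metric \<phi> h c' (transition c c' x)
        (transition_deriv c c' x v) (transition_deriv c c' x v')"
      by (simp add: rescaled_metric_def compat[OF c])
  qed
  ultimately show ?thesis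
    unfolding conformal_class_def mem_Collect_eq
    by (intro conjI exI[of _ "\<lambda>p. u p + w p"] ballI allI)
qed

section \<open>Harmonic and eikonal metrics\<close>

text \<open>With \<open>form_norm_transition\<close> these facts make powers of \<open>\<bar>\<star>\<beta>\<bar>\<close> admissible as conformal factors.\<close>

lemma norm_star_hyperform:
  assumes g: "riemannian_metric A g" and \<beta>: "\<beta> \<in> k_forms A (CARD('n) - 1)"
    and nv: "nowhere_vanishing A (CARD('n) - 1) \<beta>"
  defines "\<alpha> \<equiv> hodge_star g (CARD('n) - 1) \<beta>"
  shows "\<alpha> \<in> k_forms A 1"
    and "c \<in> A \<Longrightarrow> x \<in> chart_image c \<Longrightarrow> 0 < form_norm g 1 \<alpha> c x"
    and "c \<in> A \<Longrightarrow> smooth_on (chart_image c) (form_norm g 1 \<alpha> c)"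
proof -
  have "0 < CARD('n)" by simp
  then have dim: "CARD('n) - 1 + 1 = CARD('n)" by simp
  show \<alpha>: "\<alpha> \<in> k_forms A 1"
    unfolding \<alpha>_def by (rule hodge_star_form[OF g \<beta> dim])
  show pos: "0 < form_norm g 1 \<alpha> c x" if cx: "c \<in> A" "x \<in> chart_image c" for c x
  proof -
    obtain vs where vs: "length vs = CARD('n) - 1" "\<beta> c x vs \<noteq> 0"
      using nv cx unfolding nowhere_vanishing_def by blast
    have "alternating_multilinear (CARD('n) - 1) (\<beta> c x)"
      using \<beta> cx by (simp add: k_forms_def)
    then obtain m where m: "\<alpha> c x [axis m 1] \<noteq> 0"
      using hodge_star_hyperform_nonzero[of A g c x \<beta>, OF g cx _ vs] unfolding \<alpha>_def by blast
    have "alternating_multilinear 1 (\<alpha> c x)"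
      using \<alpha> cx by (simp add: k_forms_def)
    then show ?thesis using form_norm_1_pos[of A g c x \<alpha>, OF g cx] m by blast
  qed
  show "smooth_on (chart_image c) (form_norm g 1 \<alpha> c)" if c: "c \<in> A"
  proof -
    have "0 < 1 / fact 1 * contraction (matrix_inv (gram g c x)) 1 (\<alpha> c x) (\<alpha> c x)"
      if "x \<in> chart_image c" for x
      using pos[OF c that] unfolding form_norm_contraction real_sqrt_gt_0_iff .
    moreover have "smooth_on (chart_image c) (\<lambda>x. \<alpha> c x (frame I))" if "length I = 1" for I :: "'n list"
      using \<alpha> c that by (simp add: k_forms_def)
    ultimately have "smooth_on (chart_image c)
        (\<lambda>x. sqrt (1 / fact 1 * contraction (matrix_inv (gram g c x)) 1 (\<alpha> c x) (\<alpha> c x)))"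
      by (intro smooth_on_sqrt smooth_on_mult smooth_on_const smooth_on_contraction_gram[OF g c])
    then show ?thesis by (simp add: form_norm_contraction[abs_def])
  qed
qed

text \<open>The metric \<open>h' = \<bar>\<alpha>\<bar>\<^sup>2 h\<close> is the one in which the closed form \<open>\<alpha> = \<star>\<beta>\<close> has norm 1. Since the
  star of \<open>\<beta>\<close> in \<open>h'\<close> is a positive multiple of \<open>\<alpha>\<close>, the form \<open>\<alpha>\<close> itself is its normalization.\<close>

lemma harmonic_imp_eikonal:
  assumes "2 \<le> CARD('n)" and nv: "nowhere_vanishing A (CARD('n) - 1) \<beta>"
    and h: "h \<in> conformal_class A g" and harm: "harmonic A h \<beta>"
  shows "\<exists>h'\<in>conformal_class A g. eikonal A h' \<beta>"
proof -
  define k where "k = CARD('n) - 1"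
  define \<alpha> where "\<alpha> = hodge_star h k \<beta>"
  define \<phi> where "\<phi> = form_norm h 1 \<alpha>"
  define h' where "h' = rescaled_metric \<phi> h"
  have metric: "riemannian_metric A h" using h by (simp add: conformal_class_def)
  have flux: "flux_form A \<beta>" and closed: "closed_form A 1 \<alpha>"
    using harm by (auto simp: harmonic_def \<alpha>_def k_def)
  then have \<beta>: "\<beta> \<in> k_forms A (CARD('n) - 1)" by (simp add: flux_form_def)
  note star = norm_star_hyperform[OF metric \<beta> nv, folded k_def, folded \<alpha>_def, folded \<phi>_def]
  have h'_conf: "h' \<in> conformal_class A g"
    unfolding h'_def
    by (rule rescaled_metric_conformal[OF h star(2,3)])
      (simp_all only: \<phi>_def form_norm_transition[OF metric star(1)])
  have "normalization A h' 1 (hodge_star h' k \<beta>) \<alpha>"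
    unfolding normalization_def
  proof (intro conjI ballI allI impI star(1))
    fix c x assume cx: "c \<in> A" "x \<in> chart_image c"
    define s where "s = 1 / \<phi> c x ^ (CARD('n) - 2)"
    have pos: "0 < \<phi> c x" by (rule star(2)[OF cx])
    have s: "0 < s" using pos by (simp add: s_def)
    have inv: "invertible (gram h c x)" by (rule gram_invertible[OF metric cx])
    have star': "hodge_star h' k \<beta> c x vs = s * \<alpha> c x vs" for vs
      using hodge_star_hyperform_rescaled[of \<phi>, OF pos inv assms(1)]
      by (simp add: h'_def \<alpha>_def k_def s_def)
    have unit: "form_norm h' 1 \<alpha> c x = 1"
      using form_norm_rescaled[of \<phi>, OF pos inv, of 1 \<alpha>] pos by (simp add: h'_def \<phi>_def)
    then show "form_norm h' 1 \<alpha> c x \<le> 1" by simp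
    show "form_norm h' 1 (hodge_star h' k \<beta>) c x * \<alpha> c x vs = hodge_star h' k \<beta> c x vs" for vs
      using form_norm_cmult[of 1 "hodge_star h' k \<beta>" c x s \<alpha> h', OF star'] unit s star' by simp
  qed
  then have "eikonal A h' \<beta>"
    using flux closed unfolding eikonal_def k_def by blast
  then show ?thesis using h'_conf by blast
qed

text \<open>A normalization of the nowhere vanishing form \<open>\<star>\<beta>\<close> is \<open>\<star>\<beta> / \<bar>\<star>\<beta>\<bar>\<close>. Rescaling by \<open>\<phi>\<close> divides the
  star by \<open>\<phi>\<^sup>n\<^sup>-\<^sup>2\<close>, so the root of order \<open>n - 2\<close> of the norm is the conformal
  factor for which the star equals this normalization.\<close>

lemma eikonal_imp_harmonic:
  assumes dim: "3 \<le> CARD('n)" and nv: "nowhere_vanishing A (CARD('n) - 1) \<beta>"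
    and h: "h \<in> conformal_class A g" and eik: "eikonal A h \<beta>"
  shows "\<exists>h'\<in>conformal_class A g. harmonic A h' \<beta>"
proof -
  define k where "k = CARD('n) - 1"
  define \<alpha> where "\<alpha> = hodge_star h k \<beta>"
  define N where "N = form_norm h 1 \<alpha>"
  define \<phi> where "\<phi> c x = N c x powr (1 / real (CARD('n) - 2))" for c x
  define h' where "h' = rescaled_metric \<phi> h"
  have metric: "riemannian_metric A h" using h by (simp add: conformal_class_def)
  obtain \<eta> where flux: "flux_form A \<beta>" and \<eta>: "normalization A h 1 \<alpha> \<eta>" "closed_form A 1 \<eta>"
    using eik unfolding eikonal_def \<alpha>_def k_def by blast
  then have \<beta>: "\<beta> \<in> k_forms A (CARD('n) - 1)" by (simp add: flux_form_def)
  note star = norm_star_hyperform[OF metric \<beta> nv, folded k_def, folded \<alpha>_def, folded N_def]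
  have pos: "0 < \<phi> c x" if "c \<in> A" "x \<in> chart_image c" for c x
    using star(2)[OF that] by (simp add: \<phi>_def)
  have h'_conf: "h' \<in> conformal_class A g"
    unfolding h'_def
  proof (rule rescaled_metric_conformal[OF h pos])
    show "smooth_on (chart_image c) (\<phi> c)" if "c \<in> A" for c
      unfolding \<phi>_def[abs_def] by (rule smooth_on_powr[OF star(3)[OF that] star(2)[OF that]])
    show "\<phi> c' (transition c c' x) = \<phi> c x" if "c \<in> A" "c' \<in> A" "x \<in> overlap c c'" for c c' x
      by (simp only: \<phi>_def N_def form_norm_transition[OF metric star(1) that])
  qed
  have "\<eta> c x vs = hodge_star h' k \<beta> c x vs"
    if cx: "c \<in> A" "x \<in> chart_image c" and vs: "length vs = 1" for c x vs
  proof -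
    have N: "0 < N c x" by (rule star(2)[OF cx])
    \<comment> \<open>the exponent \<open>n - 2\<close> is positive only for \<open>n \<ge> 3\<close>\<close>
    have "\<phi> c x ^ (CARD('n) - 2) = N c x"
      using N dim pos[OF cx] by (simp add: \<phi>_def powr_realpow[symmetric] powr_powr)
    then have "hodge_star h' k \<beta> c x vs = \<alpha> c x vs / N c x"
      using hodge_star_hyperform_rescaled[of \<phi>, OF pos[OF cx] gram_invertible[OF metric cx]] dim
      by (simp add: h'_def \<alpha>_def k_def)
    moreover have "N c x * \<eta> c x vs = \<alpha> c x vs"
      using \<eta>(1) cx vs unfolding normalization_def N_def by blast
    ultimately have "N c x * \<eta> c x vs = N c x * hodge_star h' k \<beta> c x vs" using N by simp
    then show ?thesis using N by simp
  qed
  then have "closed_form A 1 (hodge_star h' k \<beta>)"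
    using closed_form_cong \<eta>(2) by blast
  then have "harmonic A h' \<beta>" using flux by (simp add: harmonic_def k_def)
  then show ?thesis using h'_conf by blast
qed

end

theorem theorem1p3:
  fixes M :: "'a topology"
    and A :: "('a,'n::{finite,wellorder}) chart set"
    and g :: "('a,'n) metric"
    and \<beta> :: "('a,'n) form"
  assumes "CARD('n) \<ge> 3"
    and "smooth_manifold_with_boundary M A"
    and "oriented_atlas A"
    and "riemannian_metric A g"
    and "\<beta> \<in> k_forms A (CARD('n) - 1)"
    and "closed_form A (CARD('n) - 1) \<beta>"
    and "nowhere_vanishing A (CARD('n) - 1) \<beta>"
  shows "(\<exists>h\<in>conformal_class A g. harmonic A h \<beta>) \<longleftrightarrow> (\<exists>h\<in>conformal_class A g. eikonal A h \<beta>)"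
proof -
  interpret oriented_manifold M A
    using assms(2,3) by unfold_locales
  have "2 \<le> CARD('n)" using assms(1) by simp
  then show ?thesis
    using harmonic_imp_eikonal[OF _ assms(7)] eikonal_imp_harmonic[OF assms(1,7)] by blast
qed

end
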